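(* Let $n\geq0$. For every object $\underline X=(X,a,b)$ of $\mathbf{Top}_2$, the group morphism $\mathbb Z\pi_1(a,b)\to\mathbf H_n(\underline X)$ sending the class of a path $\tilde\gamma\in\mathrm{Chem}(a,b)$ to $[\tilde\gamma^{(n)}]$ induces a group morphism $\nu^{(n)}_{\underline X}:\mathbf F_n(\underline X)\to\mathbf H_n(\underline X)$. The assignment $\underline X\mapsto\nu^{(n)}_{\underline X}$ is a natural transformation from the functor $\mathbf F_n$ to the functor $\mathbf H_n$ (functors from $\mathbf{Top}_2$ to abelian groups).
   Context: $\mathbf{Top}_2$ is the category of triples $(X,a,b)$ with $X$ a topological space and $a,b\in X$; a morphism $(X,a,b)\to(X',a',b')$ is a continuous map $f:X\to X'$ with $f(a)=a'$, $f(b)=b'$. $\mathrm{Chem}(a,b)$ is the set of continuous maps $\tilde\gamma:[0,1]\to X$ with $\tilde\gamma(0)=a$, $\tilde\gamma(1)=b$; $\pi_1(a,b)$ is its quotient by homotopy with fixed endpoints; $\pi_1(a):=\pi_1(a,a)$; the product $\gamma\cdot\alpha$ is the class of the path running first along $\alpha$, then along $\gamma$, so $\mathbb Z\pi_1(a,b)$ is a right module over the group ring $\mathbb Z\pi_1(a)$, whose augmentation ideal is $(\mathbb Z\pi_1(a))_+$. $\mathbf F_n(X,a,b):=\mathbb Z\pi_1(a,b)/(\mathbb Z\pi_1(a,b)\cdot(\mathbb Z\pi_1(a))_+^{n+1})$, functorial in $(X,a,b)$ through composition of paths with $f$. $Y^{(n)}_{ab}:=\bigcup_{i=0}^n\{(x_1,\ldots,x_n)\in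 X^n\mid x_i=x_{i+1}\}$ with $x_0=a$, $x_{n+1}=b$. (For $n=0$, $X^0$ is a point and $Y^{(0)}_{ab}$ is the whole point if $a=b$ and empty otherwise.) $\mathbf H_n(X,a,b):=\mathrm H_n(X^n,Y^{(n)}_{ab})$, relative singular homology with coefficients in $\mathbb Z$, functorial through the maps of pairs $f^n:(X^n,Y^{(n)}_{ab})\to(X'^n,Y^{(n)}_{a'b'})$. $\Delta^n:=\{(t_1,\ldots,t_n)\in\mathbb R^n\mid 0\leq t_1\leq\cdots\leq t_n\leq1\}$ is the standard simplex used for singular chains, with singular differential $c\mapsto\sum_{i=0}^n(-1)^ic\circ\partial_i^n$, $\partial_i^n(t_1,\ldots,t_{n-1})=(t_1,\ldots,t_i,t_i,\ldots,t_{n-1})$ ($t_0=0$, $t_n=1$). $\tilde\gamma^{(n)}:\Delta^n\to X^n$ is $(t_1,\ldots,t_n)\mapsto(\tilde\gamma(t_1),\ldots,\tilde\gamma(t_n))$, a relative cycle for $(X^n,Y^{(n)}_{ab})$ whose class $[\tilde\gamma^{(n)}]\in\mathrm H_n(X^n,Y^{(n)}_{ab})$ depends only on the homotopy class of $\tilde\gamma$. *)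

theory Defs
  imports
    "HOL-Homology.Homology"
    "HOL-Algebra.Ideal_Product"
begin

section \<open>The category of spaces with two points\<close>

text \<open>Morphisms are \<^const>\<open>extensional\<close>, so that two morphisms are equal as HOL functions
  iff they agree on the underlying space.\<close>

type_synonym 'a top2 = "'a topology \<times> 'a \<times> 'a"

definition top2_obj :: "'a top2 \<Rightarrow> bool" where
  "top2_obj = (\<lambda>(X, a, b). a \<in> topspace X \<and> b \<in> topspace X)"

definition top2_hom :: "'a top2 \<Rightarrow> 'b top2 \<Rightarrow> ('a \<Rightarrow> 'b) set" where
  "top2_hom = (\<lambda>(X, a, b) (X', a', b').
     {f \<in> extensional (topspace X). continuous_map X X' f \<and> f a = a' \<and> f b = b'})"

definition top2_id :: "'a top2 \<Rightarrow> 'a \<Rightarrow> 'a" where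
  "top2_id = (\<lambda>(X, a, b). \<lambda>x\<in>topspace X. x)"

definition top2_comp :: "'a top2 \<Rightarrow> ('b \<Rightarrow> 'c) \<Rightarrow> ('a \<Rightarrow> 'b) \<Rightarrow> 'a \<Rightarrow> 'c" where
  "top2_comp = (\<lambda>(X, a, b) g f. compose (topspace X) g f)"


section \<open>Paths and the fundamental groupoid\<close>

text \<open>A path is a total function on the reals of which only the values on $[0,1]$ matter: neither
  \<^const>\<open>pathin\<close> nor the homotopy relation looks at other values, so that a homotopy class
  contains all extensions of its members. The library's \<open>homotopic_paths\<close> and \<open>joinpaths\<close> are
  restricted to type-class topologies; the definitions below are their analogues for
  \<^typ>\<open>'a topology\<close>.\<close>

definition Chem :: "'a topology \<Rightarrow> 'a \<Rightarrow> 'a \<Rightarrow> (real \<Rightarrow> 'a) set" where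
  "Chem X a b = {\<gamma>. pathin X \<gamma> \<and> \<gamma> 0 = a \<and> \<gamma> 1 = b}"

definition path_homotopic :: "'a topology \<Rightarrow> (real \<Rightarrow> 'a) \<Rightarrow> (real \<Rightarrow> 'a) \<Rightarrow> bool" where
  "path_homotopic X \<gamma> \<delta> \<longleftrightarrow>
     homotopic_with (\<lambda>h. h 0 = \<gamma> 0 \<and> h 1 = \<gamma> 1) (top_of_set {0..1}) X \<gamma> \<delta>"

definition path_class :: "'a topology \<Rightarrow> (real \<Rightarrow> 'a) \<Rightarrow> (real \<Rightarrow> 'a) set" where
  "path_class X \<gamma> = {\<delta>. path_homotopic X \<gamma> \<delta>}"

definition pi1 :: "'a topology \<Rightarrow> 'a \<Rightarrow> 'a \<Rightarrow> (real \<Rightarrow> 'a) set set" where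
  "pi1 X a b = path_class X ` Chem X a b"

definition path_then :: "(real \<Rightarrow> 'a) \<Rightarrow> (real \<Rightarrow> 'a) \<Rightarrow> real \<Rightarrow> 'a" where
  "path_then \<alpha> \<gamma> = (\<lambda>t. if t \<le> 1/2 then \<alpha> (2 * t) else \<gamma> (2 * t - 1))"

text \<open>The product $g \cdot h$ of classes runs first along $h$.\<close>

definition pi1_mult ::
  "'a topology \<Rightarrow> (real \<Rightarrow> 'a) set \<Rightarrow> (real \<Rightarrow> 'a) set \<Rightarrow> (real \<Rightarrow> 'a) set" where
  "pi1_mult X g h = (\<Union>\<gamma>\<in>g. \<Union>\<alpha>\<in>h. path_class X (path_then \<alpha> \<gamma>))"

definition fundamental_group :: "'a topology \<Rightarrow> 'a \<Rightarrow> (real \<Rightarrow> 'a) set monoid" where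
  "fundamental_group X a =
     \<lparr>carrier = pi1 X a a, mult = pi1_mult X, one = path_class X (\<lambda>t. a)\<rparr>"


section \<open>Group rings and the functor $\mathbf F_n$\<close>

text \<open>The $\mathbb Z$-bilinear extension of a binary operation on basis elements.\<close>

definition frag_bilinear ::
  "('a \<Rightarrow> 'b \<Rightarrow> 'c) \<Rightarrow> ('a \<Rightarrow>\<^sub>0 int) \<Rightarrow> ('b \<Rightarrow>\<^sub>0 int) \<Rightarrow> ('c \<Rightarrow>\<^sub>0 int)" where
  "frag_bilinear m u v = frag_extend (\<lambda>x. frag_extend (\<lambda>y. frag_of (m x y)) v) u"

definition group_ring :: "('g, 'm) monoid_scheme \<Rightarrow> ('g \<Rightarrow>\<^sub>0 int) ring" where
  "group_ring G =
     \<lparr>carrier = carrier (free_Abelian_group (carrier G)),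
      mult = frag_bilinear (mult G), one = frag_of \<one>\<^bsub>G\<^esub>, zero = 0, add = (+)\<rparr>"

definition augmentation :: "('g \<Rightarrow>\<^sub>0 int) \<Rightarrow> int" where
  "augmentation u = (\<Sum>g\<in>Poly_Mapping.keys u. Poly_Mapping.lookup u g)"

definition augmentation_ideal :: "('g, 'm) monoid_scheme \<Rightarrow> ('g \<Rightarrow>\<^sub>0 int) set" where
  "augmentation_ideal G = {u \<in> carrier (group_ring G). augmentation u = 0}"

definition Zpi1 :: "'a top2 \<Rightarrow> ((real \<Rightarrow> 'a) set \<Rightarrow>\<^sub>0 int) monoid" where
  "Zpi1 = (\<lambda>(X, a, b). free_Abelian_group (pi1 X a b))"

text \<open>The submodule $\mathbb Z\pi_1(a,b) \cdot (\mathbb Z\pi_1(a))_+^{n+1}$; the power of the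
  augmentation ideal is taken in the monoid of ideals \<^const>\<open>ideals_set\<close>.\<close>

definition Zpi1_sub :: "nat \<Rightarrow> 'a top2 \<Rightarrow> ((real \<Rightarrow> 'a) set \<Rightarrow>\<^sub>0 int) set" where
  "Zpi1_sub n = (\<lambda>(X, a, b).
     let G = fundamental_group X a in
       generate (Zpi1 (X, a, b))
         {frag_bilinear (pi1_mult X) u r |u r.
            u \<in> carrier (Zpi1 (X, a, b)) \<and>
            r \<in> augmentation_ideal G [^]\<^bsub>ideals_set (group_ring G)\<^esub> (n + 1)})"

definition F_obj :: "nat \<Rightarrow> 'a top2 \<Rightarrow> ((real \<Rightarrow> 'a) set \<Rightarrow>\<^sub>0 int) set monoid" where
  "F_obj n \<X> = Zpi1 \<X> Mod Zpi1_sub n \<X>"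

definition F_proj ::
  "nat \<Rightarrow> 'a top2 \<Rightarrow> ((real \<Rightarrow> 'a) set \<Rightarrow>\<^sub>0 int) \<Rightarrow> ((real \<Rightarrow> 'a) set \<Rightarrow>\<^sub>0 int) set" where
  "F_proj n \<X> u = Zpi1_sub n \<X> #>\<^bsub>Zpi1 \<X>\<^esub> u"

text \<open>The map on a quotient induced by a map \<open>h\<close> that is constant on cosets: a coset is sent to the
  only value of \<open>h\<close> on it.\<close>

definition induced_map :: "('a \<Rightarrow> 'b) \<Rightarrow> 'a set \<Rightarrow> 'b" where
  "induced_map h C = the_elem (h ` C)"

definition pi1_map ::
  "'b topology \<Rightarrow> ('a \<Rightarrow> 'b) \<Rightarrow> (real \<Rightarrow> 'a) set \<Rightarrow> (real \<Rightarrow> 'b) set" where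
  "pi1_map X' f g = (\<Union>\<gamma>\<in>g. path_class X' (f \<circ> \<gamma>))"

definition F_mor ::
  "nat \<Rightarrow> 'a top2 \<Rightarrow> 'b top2 \<Rightarrow> ('a \<Rightarrow> 'b) \<Rightarrow>
     ((real \<Rightarrow> 'a) set \<Rightarrow>\<^sub>0 int) set \<Rightarrow> ((real \<Rightarrow> 'b) set \<Rightarrow>\<^sub>0 int) set" where
  "F_mor n \<X> \<Y> f =
     induced_map (\<lambda>u. F_proj n \<Y> (frag_extend (\<lambda>g. frag_of (pi1_map (fst \<Y>) f g)) u))"


section \<open>The functor $\mathbf H_n$\<close>

definition top_power :: "nat \<Rightarrow> 'a topology \<Rightarrow> (nat \<Rightarrow> 'a) topology" where
  "top_power n X = product_topology (\<lambda>i. X) {1..n}"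

definition bounded_coord :: "nat \<Rightarrow> 'a \<Rightarrow> 'a \<Rightarrow> (nat \<Rightarrow> 'a) \<Rightarrow> nat \<Rightarrow> 'a" where
  "bounded_coord n a b x i = (if i = 0 then a else if i = n + 1 then b else x i)"

definition diag_union :: "nat \<Rightarrow> 'a top2 \<Rightarrow> (nat \<Rightarrow> 'a) set" where
  "diag_union n = (\<lambda>(X, a, b).
     \<Union>i\<in>{0..n}. {x \<in> topspace (top_power n X).
        bounded_coord n a b x i = bounded_coord n a b x (i + 1)})"

definition H_obj :: "nat \<Rightarrow> 'a top2 \<Rightarrow> (nat \<Rightarrow> 'a) chain set monoid" where
  "H_obj n \<X> = relative_homology_group (int n) (top_power n (fst \<X>)) (diag_union n \<X>)"

definition H_mor ::
  "nat \<Rightarrow> 'a top2 \<Rightarrow> 'b top2 \<Rightarrow> ('a \<Rightarrow> 'b) \<Rightarrow> (nat \<Rightarrow> 'a) chain set \<Rightarrow> (nat \<Rightarrow> 'b) chain set" where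
  "H_mor n \<X> \<Y> f =
     hom_induced (int n) (top_power n (fst \<X>)) (diag_union n \<X>)
       (top_power n (fst \<Y>)) (diag_union n \<Y>) (\<lambda>x. \<lambda>i\<in>{1..n}. f (x i))"


section \<open>The simplices of a path and the morphism $\nu^{(n)}$\<close>

text \<open>The library's standard simplex uses barycentric coordinates $s_0, \ldots, s_n$. They
  correspond to $0 \le t_1 \le \cdots \le t_n \le 1$ through $t_i = s_0 + \cdots + s_{i-1}$.
  Under this identification inserting a zero at position $i$ is
  $(t_1,\ldots,t_{n-1}) \mapsto (t_1,\ldots,t_i,t_i,\ldots,t_{n-1})$, so the differentials agree.\<close>

definition path_simplex :: "nat \<Rightarrow> (real \<Rightarrow> 'a) \<Rightarrow> (nat \<Rightarrow> real) \<Rightarrow> nat \<Rightarrow> 'a" where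
  "path_simplex n \<gamma> = (\<lambda>s\<in>standard_simplex n. \<lambda>i\<in>{1..n}. \<gamma> (\<Sum>j<i. s j))"

definition path_simplex_class :: "nat \<Rightarrow> 'a top2 \<Rightarrow> (real \<Rightarrow> 'a) \<Rightarrow> (nat \<Rightarrow> 'a) chain set" where
  "path_simplex_class n \<X> \<gamma> =
     homologous_rel_set n (top_power n (fst \<X>)) (diag_union n \<X>) (frag_of (path_simplex n \<gamma>))"

text \<open>The homomorphism from a free abelian group to a commutative group \<open>G\<close> (written
  multiplicatively) with prescribed values on the basis.\<close>

definition free_Abelian_hom ::
  "('b, 'm) monoid_scheme \<Rightarrow> ('a \<Rightarrow> 'b) \<Rightarrow> ('a \<Rightarrow>\<^sub>0 int) \<Rightarrow> 'b" where
  "free_Abelian_hom G h u =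
     finprod G (\<lambda>x. h x [^]\<^bsub>G\<^esub> Poly_Mapping.lookup u x) (Poly_Mapping.keys u)"

definition Zpi1_to_H ::
  "nat \<Rightarrow> 'a top2 \<Rightarrow> ((real \<Rightarrow> 'a) set \<Rightarrow>\<^sub>0 int) \<Rightarrow> (nat \<Rightarrow> 'a) chain set" where
  "Zpi1_to_H n \<X> =
     free_Abelian_hom (H_obj n \<X>) (induced_map (path_simplex_class n \<X>))"

definition nu ::
  "nat \<Rightarrow> 'a top2 \<Rightarrow> ((real \<Rightarrow> 'a) set \<Rightarrow>\<^sub>0 int) set \<Rightarrow> (nat \<Rightarrow> 'a) chain set" where
  "nu n \<X> = induced_map (Zpi1_to_H n \<X>)"

end

theory Submission
  imports Defs
begin

text \<open>The module \<open>\<int>\<pi>\<^sub>1(a,b) \<cdot> I\<^sup>m\<close> is spanned by the alternating sums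
  \<open>\<Sum>\<^bsub>S \<subseteq> {1..m}\<^esub> (-1)\<^bsup>m - |S|\<^esup> \<gamma> \<cdot> \<Prod>\<^bsub>i \<in> S\<^esub> g\<^sub>i\<close>, with \<open>\<gamma>\<close> a class of paths
  from \<open>a\<close> to \<open>b\<close> and \<open>g\<^sub>i\<close> loops. Represent each term by a path that runs through the \<open>i\<close>-th loop
  (or stays at \<open>a\<close>, if \<open>i \<notin> S\<close>) during a closed time interval \<open>J\<^sub>i\<close>, these intervals being pairwise
  disjoint. For \<open>m = n + 1\<close>, at any point of the \<open>n\<close>-simplex some \<open>J\<^sub>i\<close> contains none of the \<open>n\<close>
  times \<open>t\<^sub>1, \<dots>, t\<^sub>n\<close>, so the open sets where a given \<open>J\<^sub>i\<close> is avoided cover the simplex, and an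
  iterated barycentric subdivision is subordinate to this cover. On each small simplex, switching
  the \<open>i\<close>-th loop on or off makes no difference, so that the subdivided alternating chain vanishes.\<close>

section \<open>Homotopy of paths in an abstract topology\<close>

lemma path_homotopic_refl:
  "\<gamma> \<in> Chem X a b \<Longrightarrow> path_homotopic X \<gamma> \<gamma>"
  by (simp add: Chem_def pathin_def path_homotopic_def)

lemma path_homotopic_Chem:
  assumes "path_homotopic X \<gamma> \<delta>" "\<gamma> \<in> Chem X a b"
  shows "\<delta> \<in> Chem X a b"
  using homotopic_with_imp_continuous_maps [of _ _ _ \<gamma> \<delta>]
    homotopic_with_imp_property [of _ _ _ \<gamma> \<delta>] assms
  by (fastforce simp: Chem_def pathin_def path_homotopic_def)

text \<open>The endpoint condition in \<open>path_homotopic\<close> names only the first path, so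
  exchanging the paths needs that both have the same endpoints.\<close>

lemma path_homotopic_sym:
  assumes "path_homotopic X \<gamma> \<delta>"
  shows "path_homotopic X \<delta> \<gamma>"
proof -
  have "\<delta> 0 = \<gamma> 0" "\<delta> 1 = \<gamma> 1"
    using homotopic_with_imp_property [OF assms[unfolded path_homotopic_def]] by auto
  then show ?thesis
    using assms homotopic_with_symD by (fastforce simp: path_homotopic_def)
qed

lemma path_homotopic_trans:
  assumes "path_homotopic X \<gamma> \<delta>" "path_homotopic X \<delta> \<epsilon>"
  shows "path_homotopic X \<gamma> \<epsilon>"
proof -
  have "\<delta> 0 = \<gamma> 0" "\<delta> 1 = \<gamma> 1"
    using homotopic_with_imp_property [OF assms(1)[unfolded path_homotopic_def]] by auto
  then show ?thesis
    using assms homotopic_with_trans by (fastforce simp: path_homotopic_def)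
qed

lemma path_homotopic_eqI:
  assumes "\<gamma> \<in> Chem X a b" "\<And>t. 0 \<le> t \<Longrightarrow> t \<le> 1 \<Longrightarrow> \<delta> t = \<gamma> t"
  shows "path_homotopic X \<gamma> \<delta>"
  using assms unfolding path_homotopic_def Chem_def pathin_def
  by (intro homotopic_with_equal) auto

text \<open>The straight-line homotopy from the identity to \<phi> stays inside the convex set [0,1]
  and fixes 0 and 1; composing it with \<gamma> gives the homotopy.\<close>

lemma path_homotopic_reparam:
  assumes "\<gamma> \<in> Chem X a b" and "continuous_on {0..1} \<phi>" and "\<phi> \<in> {0..1} \<rightarrow> {0..1}"
    and "\<phi> 0 = 0" "\<phi> 1 = 1" and "\<And>t. 0 \<le> t \<Longrightarrow> t \<le> 1 \<Longrightarrow> \<delta> t = \<gamma> (\<phi> t)"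
  shows "path_homotopic X \<gamma> \<delta>"
proof -
  have "homotopic_with_canon (\<lambda>h. h 0 = 0 \<and> h 1 = 1) {0..1} {0..1} id \<phi>"
    unfolding homotopic_with_def
  proof (intro exI[of _ "\<lambda>z. (1 - fst z) * snd z + fst z * \<phi> (snd z)"] conjI allI ballI)
    have "continuous_on ({0..1} \<times> {0..1}) (\<lambda>z::real\<times>real. (1 - fst z) * snd z + fst z * \<phi> (snd z))"
      by (intro continuous_intros continuous_on_compose2[OF assms(2)]) auto
    moreover have "(1 - s) * t + s * \<phi> t \<in> {0..1}" if "s \<in> {0..1}" "t \<in> {0..1}" for s t
    proof -
      have "(1 - s) * t + s * \<phi> t \<le> (1 - s) * 1 + s * 1"
        using that assms(3) by (intro add_mono mult_left_mono) auto
      then show ?thesis using that assms(3) by (auto simp: Pi_iff)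
    qed
    ultimately show "continuous_map (prod_topology (top_of_set {0..1}) (top_of_set {0..1}))
        (top_of_set {0..1}) (\<lambda>z. (1 - fst z) * snd z + fst z * \<phi> (snd z))"
      by (auto simp: continuous_map_in_subtopology simp flip: subtopology_Times)
  qed (auto simp: assms)
  then have "homotopic_with (\<lambda>h. h 0 = \<gamma> 0 \<and> h 1 = \<gamma> 1) (top_of_set {0..1}) X (\<gamma> \<circ> id) (\<gamma> \<circ> \<phi>)"
    using assms(1) by (elim homotopic_with_compose_continuous_map_left) (auto simp: Chem_def pathin_def)
  then have hom: "path_homotopic X \<gamma> (\<gamma> \<circ> \<phi>)"
    by (simp add: path_homotopic_def)
  \<comment> \<open>Outside [0,1] the functions \<delta> and \<open>\<gamma> \<circ> \<phi>\<close>
    may differ.\<close>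
  moreover have "path_homotopic X (\<gamma> \<circ> \<phi>) \<delta>"
  proof (rule path_homotopic_eqI)
    show "\<gamma> \<circ> \<phi> \<in> Chem X a b"
      using path_homotopic_Chem[OF hom] assms by blast
  qed (use assms in auto)
  ultimately show ?thesis
    by (rule path_homotopic_trans)
qed

text \<open>Concatenate the two homotopies at each value of the homotopy parameter. They agree at
  time 1/2, since both keep their endpoints fixed and \<alpha> ends where \<gamma> begins.\<close>

lemma path_homotopic_path_then:
  assumes "path_homotopic X \<alpha> \<alpha>'" "path_homotopic X \<gamma> \<gamma>'" "\<alpha> 1 = \<gamma> 0"
  shows "path_homotopic X (path_then \<alpha> \<gamma>) (path_then \<alpha>' \<gamma>')"
proof -
  let ?I = "top_of_set {0..1::real}"
  let ?II = "prod_topology ?I ?I"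
  obtain h where h: "continuous_map ?II X h" "\<And>x. h (0, x) = \<alpha> x" "\<And>x. h (1, x) = \<alpha>' x"
      "\<And>t. t \<in> {0..1} \<Longrightarrow> h (t, 0) = \<alpha> 0 \<and> h (t, 1) = \<alpha> 1"
    using assms(1) unfolding path_homotopic_def homotopic_with_def by auto
  obtain k where k: "continuous_map ?II X k" "\<And>x. k (0, x) = \<gamma> x" "\<And>x. k (1, x) = \<gamma>' x"
      "\<And>t. t \<in> {0..1} \<Longrightarrow> k (t, 0) = \<gamma> 0 \<and> k (t, 1) = \<gamma> 1"
    using assms(2) unfolding path_homotopic_def homotopic_with_def by auto
  let ?f = "\<lambda>z. if snd z \<le> 1/2 then (h \<circ> (\<lambda>x. (fst x, 2 *\<^sub>R snd x))) z
                else (k \<circ> (\<lambda>x. (fst x, 2 *\<^sub>R snd x - 1))) z"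
  have snd: "continuous_map ?II euclideanreal snd" and fst: "continuous_map ?II euclideanreal fst"
    using continuous_map_snd continuous_map_fst continuous_map_in_subtopology by blast+
  have "continuous_map ?II X ?f"
  proof (rule continuous_map_cases_le)
    show "continuous_map (subtopology ?II {y \<in> topspace ?II. snd y \<le> 1/2}) X
        (h \<circ> (\<lambda>x. (fst x, 2 *\<^sub>R snd x)))"
      apply (intro fst snd continuous_map_compose [OF _ h(1)] continuous_intros
          continuous_map_into_subtopology continuous_map_from_subtopology | simp)+
      by (force simp: prod_topology_subtopology)
    show "continuous_map (subtopology ?II {y \<in> topspace ?II. 1/2 \<le> snd y}) X
        (k \<circ> (\<lambda>x. (fst x, 2 *\<^sub>R snd x - 1)))"
      apply (intro fst snd continuous_map_compose [OF _ k(1)] continuous_intros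
          continuous_map_into_subtopology continuous_map_from_subtopology | simp)+
      by (force simp: prod_topology_subtopology)
    show "(h \<circ> (\<lambda>x. (fst x, 2 *\<^sub>R snd x))) y = (k \<circ> (\<lambda>x. (fst x, 2 *\<^sub>R snd x - 1))) y"
      if "y \<in> topspace ?II" "snd y = 1/2" for y
    proof -
      have "fst y \<in> {0..1}" using that(1) by auto
      then show ?thesis using h(4) k(4) assms(3) by (simp add: that(2))
    qed
  qed (use snd in auto)
  then show ?thesis
    unfolding path_homotopic_def homotopic_with_def using h k
    by (intro exI[of _ ?f]) (auto simp: path_then_def)
qed

text \<open>Continuity of the concatenation is read off from the constant homotopies: a homotopy has
  continuous paths at both ends.\<close>

lemma Chem_path_then:
  assumes "\<alpha> \<in> Chem X a b" "\<gamma> \<in> Chem X b c"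
  shows "path_then \<alpha> \<gamma> \<in> Chem X a c"
proof -
  have "path_homotopic X (path_then \<alpha> \<gamma>) (path_then \<alpha> \<gamma>)"
    using assms by (intro path_homotopic_path_then path_homotopic_refl) (auto simp: Chem_def)
  then show ?thesis
    using assms by (auto simp: path_homotopic_def Chem_def pathin_def path_then_def)
qed

lemma Chem_const: "a \<in> topspace X \<Longrightarrow> (\<lambda>_. a) \<in> Chem X a a"
  by (simp add: Chem_def)

lemma Chem_topspace: "\<gamma> \<in> Chem X a b \<Longrightarrow> a \<in> topspace X \<and> b \<in> topspace X"
  using path_start_in_topspace path_finish_in_topspace by (fastforce simp: Chem_def)

lemma Chem_compose:
  "\<lbrakk>\<gamma> \<in> Chem X a b; continuous_map X Y f\<rbrakk> \<Longrightarrow> f \<circ> \<gamma> \<in> Chem Y (f a) (f b)"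
  by (auto simp: Chem_def pathin_compose)

lemma path_homotopic_compose:
  "\<lbrakk>path_homotopic X \<gamma> \<delta>; continuous_map X Y f\<rbrakk> \<Longrightarrow> path_homotopic Y (f \<circ> \<gamma>) (f \<circ> \<delta>)"
  unfolding path_homotopic_def by (erule homotopic_with_compose_continuous_map_left) auto

lemma path_homotopic_const_then:
  assumes "\<gamma> \<in> Chem X a b"
  shows "path_homotopic X \<gamma> (path_then (\<lambda>_. a) \<gamma>)"
proof (rule path_homotopic_reparam)
  show "continuous_on {0..1} (\<lambda>t::real. max 0 (2 * t - 1))"
    by (intro continuous_intros)
  show "path_then (\<lambda>_. a) \<gamma> t = \<gamma> (max 0 (2 * t - 1))" for t
    using assms by (cases "t \<le> 1/2") (simp_all add: path_then_def Chem_def max_absorb1 max_absorb2)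
qed (use assms in auto)

lemma path_homotopic_assoc:
  assumes "\<alpha> \<in> Chem X a b" "\<beta> \<in> Chem X b c" "\<gamma> \<in> Chem X c d"
  shows "path_homotopic X (path_then \<alpha> (path_then \<beta> \<gamma>)) (path_then (path_then \<alpha> \<beta>) \<gamma>)"
proof (rule path_homotopic_reparam)
  \<comment> \<open>A concave piecewise linear function with slopes 2, 1 and 1/2 is the minimum of
    its linear pieces. It breaks at 1/4 and 1/2, where the left-bracketed concatenation passes to
    its next factor.\<close>
  let ?\<phi> = "\<lambda>t::real. min (min (2 * t) (t + 1/4)) ((t + 1) / 2)"
  show "continuous_on {0..1} ?\<phi>"
    by (intro continuous_intros) auto
  show "path_then (path_then \<alpha> \<beta>) \<gamma> t = path_then \<alpha> (path_then \<beta> \<gamma>) (?\<phi> t)" for t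
  proof -
    consider "t \<le> 1/4" | "1/4 < t" "t \<le> 1/2" | "1/2 < t" by linarith
    then show ?thesis
    proof cases
      case 1
      then have "?\<phi> t = 2 * t" by auto
      with 1 show ?thesis by (simp only:) (simp add: path_then_def)
    next
      case 2
      then have "?\<phi> t = t + 1/4" by auto
      with 2 show ?thesis by (simp only:) (simp add: path_then_def algebra_simps)
    next
      case 3
      then have "?\<phi> t = (t + 1)/2" by auto
      with 3 show ?thesis by (simp only:) (simp add: path_then_def algebra_simps add_divide_distrib)
    qed
  qed
  show "path_then \<alpha> (path_then \<beta> \<gamma>) \<in> Chem X a d"
    using assms by (blast intro: Chem_path_then)
qed (auto simp: min_le_iff_disj)

section \<open>Classes of paths, their products and their images\<close>

lemma mem_path_class_self: "\<gamma> \<in> Chem X a b \<Longrightarrow> \<gamma> \<in> path_class X \<gamma>"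
  by (simp add: path_class_def path_homotopic_refl)

lemma path_class_eq: "path_homotopic X \<gamma> \<delta> \<Longrightarrow> path_class X \<delta> = path_class X \<gamma>"
  unfolding path_class_def using path_homotopic_sym path_homotopic_trans by blast

text \<open>\<open>pi1_mult\<close> and \<open>pi1_map\<close> are unions over all representatives;
  independence of the representative collapses such a union to one class.\<close>

lemma UN_path_class:
  assumes "\<gamma> \<in> Chem X a b" "\<And>\<delta>. path_homotopic X \<gamma> \<delta> \<Longrightarrow> F \<delta> = F \<gamma>"
  shows "(\<Union>\<delta>\<in>path_class X \<gamma>. F \<delta>) = F \<gamma>"
  using assms mem_path_class_self by (fastforce simp: path_class_def)

lemma pi1_mult_path_class:
  assumes "\<gamma> \<in> Chem X b c" "\<alpha> \<in> Chem X a b"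
  shows "pi1_mult X (path_class X \<gamma>) (path_class X \<alpha>) = path_class X (path_then \<alpha> \<gamma>)"
proof -
  have eq: "path_class X (path_then \<alpha>' \<gamma>') = path_class X (path_then \<alpha> \<gamma>)"
    if "path_homotopic X \<gamma> \<gamma>'" "path_homotopic X \<alpha> \<alpha>'" for \<gamma>' \<alpha>'
    using that assms by (intro path_class_eq path_homotopic_path_then) (auto simp: Chem_def)
  note refl = path_homotopic_refl[OF assms(1)] path_homotopic_refl[OF assms(2)]
  have inner: "(\<Union>\<alpha>'\<in>path_class X \<alpha>. path_class X (path_then \<alpha>' \<gamma>')) = path_class X (path_then \<alpha> \<gamma>)"
    if "path_homotopic X \<gamma> \<gamma>'" for \<gamma>'
    using UN_path_class[OF assms(2), of "\<lambda>\<alpha>'. path_class X (path_then \<alpha>' \<gamma>')"] eq[OF that] refl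
    by simp
  show ?thesis
    unfolding pi1_mult_def
    by (subst UN_path_class[OF assms(1)]) (simp_all add: inner refl)
qed

lemma path_class_in_pi1: "\<gamma> \<in> Chem X a b \<Longrightarrow> path_class X \<gamma> \<in> pi1 X a b"
  by (simp add: pi1_def)

lemma pi1_mult_closed: "\<lbrakk>g \<in> pi1 X b c; h \<in> pi1 X a b\<rbrakk> \<Longrightarrow> pi1_mult X g h \<in> pi1 X a c"
  by (auto simp: pi1_def pi1_mult_path_class intro!: imageI Chem_path_then)

lemma pi1_mult_assoc:
  assumes "g \<in> pi1 X c d" "h \<in> pi1 X b c" "k \<in> pi1 X a b"
  shows "pi1_mult X (pi1_mult X g h) k = pi1_mult X g (pi1_mult X h k)"
proof -
  obtain \<gamma> \<beta> \<alpha> where *: "\<gamma> \<in> Chem X c d" "\<beta> \<in> Chem X b c" "\<alpha> \<in> Chem X a b"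
      and eq: "g = path_class X \<gamma>" "h = path_class X \<beta>" "k = path_class X \<alpha>"
    using assms by (auto simp: pi1_def)
  show ?thesis
    using * path_class_eq[OF path_homotopic_assoc[OF *(3,2,1)]]
      Chem_path_then[OF *(2,1)] Chem_path_then[OF *(3,2)]
    by (simp add: eq pi1_mult_path_class)
qed

lemma pi1_map_path_class:
  assumes "\<gamma> \<in> Chem X a b" "continuous_map X Y f"
  shows "pi1_map Y f (path_class X \<gamma>) = path_class Y (f \<circ> \<gamma>)"
  unfolding pi1_map_def
  using assms by (intro UN_path_class path_class_eq path_homotopic_compose)

lemma pi1_map_closed:
  "\<lbrakk>g \<in> pi1 X a b; continuous_map X Y f\<rbrakk> \<Longrightarrow> pi1_map Y f g \<in> pi1 Y (f a) (f b)"
  by (auto simp: pi1_def pi1_map_path_class intro!: imageI Chem_compose)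

lemma pi1_map_mult:
  assumes "g \<in> pi1 X b c" "h \<in> pi1 X a b" "continuous_map X Y f"
  shows "pi1_map Y f (pi1_mult X g h) = pi1_mult Y (pi1_map Y f g) (pi1_map Y f h)"
proof -
  have "f \<circ> path_then \<alpha> \<gamma> = path_then (f \<circ> \<alpha>) (f \<circ> \<gamma>)" for \<alpha> \<gamma> :: "real \<Rightarrow> 'a"
    by (auto simp: path_then_def)
  moreover obtain \<gamma> \<alpha> where *: "\<gamma> \<in> Chem X b c" "\<alpha> \<in> Chem X a b"
      and "g = path_class X \<gamma>" "h = path_class X \<alpha>"
    using assms by (auto simp: pi1_def)
  ultimately show ?thesis
    using assms(3) Chem_path_then[OF *(2,1)] *[THEN Chem_compose, OF assms(3)]
    by (simp add: pi1_mult_path_class pi1_map_path_class)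
qed

text \<open>On [0,1] every path of the class stays in the space. This serves \<open>top2_id\<close>
  and \<open>top2_comp\<close>, which agree with the identity and the composite only there.\<close>

lemma pi1_map_cong:
  assumes "g \<in> pi1 X a b" "continuous_map X Y f" "\<And>x. x \<in> topspace X \<Longrightarrow> f' x = f x"
  shows "pi1_map Y f' g = pi1_map Y f g"
proof -
  have *: "path_class Y (f' \<circ> \<delta>) = path_class Y (f \<circ> \<delta>)" if "\<delta> \<in> Chem X a b" for \<delta>
    using that assms path_image_subset_topspace[of X \<delta>]
    by (intro path_class_eq path_homotopic_eqI[OF Chem_compose]) (auto simp: Chem_def Pi_iff)
  obtain \<gamma> where "\<gamma> \<in> Chem X a b" "g = path_class X \<gamma>"
    using assms by (auto simp: pi1_def)
  then have "\<delta> \<in> Chem X a b" if "\<delta> \<in> g" for \<delta>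
    using that path_homotopic_Chem by (auto simp: path_class_def)
  then show ?thesis
    unfolding pi1_map_def by (intro SUP_cong refl *)
qed

section \<open>Quotients, free abelian groups and group rings\<close>

text \<open>A homomorphism that kills \<open>N\<close> is constant on each coset, and cosets are
  nonempty, so \<open>induced_map\<close> picks its one value there.\<close>

lemma hom_FactGroup_induced_map:
  assumes G: "comm_group G" and N: "subgroup N G" and H: "group H"
    and h: "h \<in> hom G H" and triv: "\<And>x. x \<in> N \<Longrightarrow> h x = \<one>\<^bsub>H\<^esub>"
  shows "u \<in> carrier G \<Longrightarrow> induced_map h (N #>\<^bsub>G\<^esub> u) = h u"
    and "induced_map h \<in> hom (G Mod N) H"
proof -
  interpret G: comm_group G by fact
  interpret h: group_hom G H h using G.is_group H h by (simp add: group_hom_def group_hom_axioms_def)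
  interpret N: normal N G using N by (simp add: G.normal_iff_subgroup)
  have "h ` (N #>\<^bsub>G\<^esub> u) = {h u}" if "u \<in> carrier G" for u
  proof -
    have "h x = h u" if x: "x \<in> N #>\<^bsub>G\<^esub> u" for x
    proof -
      obtain k where "k \<in> N" "x = k \<otimes>\<^bsub>G\<^esub> u" using x by (auto simp: r_coset_def)
      then show ?thesis using \<open>u \<in> carrier G\<close> N.subset triv by (auto simp: subset_iff)
    qed
    moreover have "u \<in> N #>\<^bsub>G\<^esub> u" using that N by (rule G.rcos_self)
    ultimately show ?thesis by blast
  qed
  then show eq: "induced_map h (N #>\<^bsub>G\<^esub> u) = h u" if "u \<in> carrier G" for u
    using that by (simp add: induced_map_def)
  show "induced_map h \<in> hom (G Mod N) H"
    by (rule homI) (auto simp: FactGroup_def RCOSETS_def eq N.rcos_sum)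
qed

section \<open>Linear and bilinear extension from a basis\<close>

lemma (in comm_group) free_Abelian_hom_of:
  "h x \<in> carrier G \<Longrightarrow> free_Abelian_hom G h (frag_of x) = h x"
  by (simp add: free_Abelian_hom_def int_pow_1)

text \<open>Elements outside the support have exponent 0 and contribute the unit. Thus
  \<open>u\<close>, \<open>v\<close> and their sum can be evaluated over one common index
  set.\<close>

lemma (in comm_group) free_Abelian_hom_superset:
  assumes "h \<in> S \<rightarrow> carrier G" "Poly_Mapping.keys u \<subseteq> A" "A \<subseteq> S" "finite A"
  shows "free_Abelian_hom G h u = (\<Otimes>x\<in>A. h x [^] Poly_Mapping.lookup u x)"
  unfolding free_Abelian_hom_def
  by (rule finprod_mono_neutral_cong_left) (use assms in \<open>auto simp: in_keys_iff\<close>)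

lemma (in comm_group) free_Abelian_hom_hom:
  assumes h: "h \<in> S \<rightarrow> carrier G"
  shows "free_Abelian_hom G h \<in> hom (free_Abelian_group S) G"
proof (rule homI)
  show "free_Abelian_hom G h u \<in> carrier G" if "u \<in> carrier (free_Abelian_group S)" for u
    unfolding free_Abelian_hom_def using that h by (intro finprod_closed) auto
  fix u v
  assume uv: "u \<in> carrier (free_Abelian_group S)" "v \<in> carrier (free_Abelian_group S)"
  let ?A = "Poly_Mapping.keys u \<union> Poly_Mapping.keys v"
  have A: "?A \<subseteq> S" "finite ?A" using uv by auto
  then have "x \<in> ?A \<Longrightarrow> h x \<in> carrier G" for x
    using h by blast
  then show "free_Abelian_hom G h (u \<otimes>\<^bsub>free_Abelian_group S\<^esub> v)
      = free_Abelian_hom G h u \<otimes> free_Abelian_hom G h v"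
    using keys_add[of u v]
    by (auto simp: free_Abelian_hom_superset[OF h _ A] lookup_add int_pow_mult
        intro!: finprod_cong' simp flip: finprod_multf)
qed

lemma frag_extend_add_fun:
  "frag_extend (\<lambda>x. f x + g x) u = frag_extend f u + frag_extend g u"
  by (simp add: frag_extend_def frag_cmul_distrib2 sum.distrib)

lemma frag_extend_diff_fun:
  "frag_extend (\<lambda>x. f x - g x) u = frag_extend f u - frag_extend g u"
  using frag_extend_add_fun[of "\<lambda>x. f x - g x" g u] by simp

lemma frag_bilinear_0 [simp]: "frag_bilinear m 0 v = 0" "frag_bilinear m u 0 = 0"
  by (auto simp: frag_bilinear_def intro: frag_extend_eq_0)

lemma frag_bilinear_diff_left:
  "frag_bilinear m (u - u') v = frag_bilinear m u v - frag_bilinear m u' v"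
  by (simp add: frag_bilinear_def frag_extend_diff)

lemma frag_bilinear_diff_right:
  "frag_bilinear m u (v - v') = frag_bilinear m u v - frag_bilinear m u v'"
  by (simp add: frag_bilinear_def frag_extend_diff frag_extend_diff_fun)

lemma frag_bilinear_add_right:
  "frag_bilinear m u (v + v') = frag_bilinear m u v + frag_bilinear m u v'"
  by (simp add: frag_bilinear_def frag_extend_add frag_extend_add_fun)

lemma frag_bilinear_of [simp]: "frag_bilinear m (frag_of x) (frag_of y) = frag_of (m x y)"
  by (simp add: frag_bilinear_def)

lemma keys_frag_bilinear:
  "Poly_Mapping.keys (frag_bilinear m u v)
    \<subseteq> (\<lambda>(x, y). m x y) ` (Poly_Mapping.keys u \<times> Poly_Mapping.keys v)"
proof -
  have "Poly_Mapping.keys (frag_extend (\<lambda>y. frag_of (m x y)) v) \<subseteq> m x ` Poly_Mapping.keys v" for x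
    using keys_frag_extend[of "\<lambda>y. frag_of (m x y)" v] by auto
  then show ?thesis
    unfolding frag_bilinear_def by (intro order_trans[OF keys_frag_extend]) fastforce
qed

text \<open>By bilinearity the basis elements suffice. The sets \<open>A\<close>, \<open>B\<close>,
  \<open>C\<close> are there because path classes multiply associatively only when they are
  composable.\<close>

lemma frag_bilinear_assoc:
  assumes "\<And>x y z. \<lbrakk>x \<in> A; y \<in> B; z \<in> C\<rbrakk> \<Longrightarrow> m1 (m2 x y) z = m3 x (m4 y z)"
    and "Poly_Mapping.keys u \<subseteq> A" "Poly_Mapping.keys v \<subseteq> B" "Poly_Mapping.keys w \<subseteq> C"
  shows "frag_bilinear m1 (frag_bilinear m2 u v) w = frag_bilinear m3 u (frag_bilinear m4 v w)"
  using assms(2)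
proof (induction u rule: frag_induction)
  case (one x)
  show ?case using assms(3)
  proof (induction v rule: frag_induction)
    case (one y)
    show ?case using assms(4)
      by (induction w rule: frag_induction)
        (simp_all add: assms(1) \<open>x \<in> A\<close> \<open>y \<in> B\<close> frag_bilinear_diff_right)
  qed (simp_all add: frag_bilinear_diff_left frag_bilinear_diff_right)
qed (simp_all add: frag_bilinear_diff_left)

text \<open>The additive subgroup generated by \<open>A\<close>. Closure under differences alone
  gives negatives as 0 - b and sums as a - (0 - b), and it matches \<open>frag_induction\<close>,
  whose inductive step is a difference.\<close>

inductive_set zspan :: "'a::ab_group_add set \<Rightarrow> 'a set" for A where
  zero: "0 \<in> zspan A"
| base: "a \<in> A \<Longrightarrow> a \<in> zspan A"
| diff: "\<lbrakk>a \<in> zspan A; b \<in> zspan A\<rbrakk> \<Longrightarrow> a - b \<in> zspan A"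

lemma zspan_add: "\<lbrakk>a \<in> zspan A; b \<in> zspan A\<rbrakk> \<Longrightarrow> a + b \<in> zspan A"
  using zspan.diff[OF _ zspan.diff[OF zspan.zero]] by fastforce

text \<open>\<open>alternating_sum F e [g\<^sub>1, \<dots>, g\<^sub>m]\<close> is the sum over \<open>S \<subseteq> {1..m}\<close> of \<open>(-1)\<^bsup>m - |S|\<^esup>\<close> times the value
  of \<open>F\<close> at the list in which the \<open>g\<^sub>i\<close> with \<open>i \<notin> S\<close> are replaced by \<open>e\<close>.\<close>

fun alternating_sum :: "('x list \<Rightarrow> 'c::ab_group_add) \<Rightarrow> 'x \<Rightarrow> 'x list \<Rightarrow> 'c" where
  "alternating_sum F e [] = F []"
| "alternating_sum F e (g # gs) = alternating_sum (\<lambda>l. F (g # l)) e gs - alternating_sum (\<lambda>l. F (e # l)) e gs"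

text \<open>Any relation stable under differences passes from the terms to the whole sums. It yields
  equalities, closure properties (with \<open>P\<close> ignoring one argument), and the link between
  elements of the group ring and chains.\<close>

lemma alternating_sum_rel:
  assumes "set gs \<subseteq> L" "e \<in> L" "\<And>l. \<lbrakk>set l \<subseteq> L; length l = length gs\<rbrakk> \<Longrightarrow> P (F l) (G l)"
    and "\<And>u v u' v'. \<lbrakk>P u v; P u' v'\<rbrakk> \<Longrightarrow> P (u - u') (v - v')"
  shows "P (alternating_sum F e gs) (alternating_sum G e gs)"
  using assms(1,3)
proof (induction gs arbitrary: F G)
  case (Cons g gs)
  then show ?case using assms(2,4) by simp
qed simp

lemma alternating_sum_cong:
  assumes "set gs \<subseteq> L" "e \<in> L" "\<And>l. \<lbrakk>set l \<subseteq> L; length l = length gs\<rbrakk> \<Longrightarrow> F l = G l"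
  shows "alternating_sum F e gs = alternating_sum G e gs"
  using alternating_sum_rel[OF assms(1,2), of "(=)" F G] assms(3) by simp

lemma alternating_sum_additive:
  assumes "\<And>u v. h (u - v) = h u - h v"
  shows "h (alternating_sum F e gs) = alternating_sum (\<lambda>l. h (F l)) e gs"
  by (induction gs arbitrary: F) (simp_all add: assms)

text \<open>If \<open>F\<close> does not see the entry at position \<open>i\<close>, the subsets
  with and without that entry cancel in pairs.\<close>

lemma alternating_sum_eq_0:
  assumes "i < length gs"
    and "\<And>xs x y ys. \<lbrakk>length xs = i; length ys = length gs - Suc i\<rbrakk> \<Longrightarrow> F (xs @ x # ys) = F (xs @ y # ys)"
  shows "alternating_sum F e gs = 0"
  using assms
proof (induction gs arbitrary: i F)
  case (Cons g gs)
  show ?case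
  proof (cases i)
    case 0
    have "alternating_sum (\<lambda>l. F (g # l)) e gs = alternating_sum (\<lambda>l. F (e # l)) e gs"
      using Cons.prems(2)[of "[]"] 0 by (intro alternating_sum_cong[of _ UNIV]) auto
    then show ?thesis by simp
  next
    case (Suc j)
    have "alternating_sum (\<lambda>l. F (z # l)) e gs = 0" for z
    proof (rule Cons.IH[of j])
      show "F (z # xs @ x # ys) = F (z # xs @ y # ys)"
        if "length xs = j" "length ys = length gs - Suc j" for xs x y ys
        using Cons.prems(2)[of "z # xs"] that Suc by simp
    qed (use Cons.prems Suc in simp)
    then show ?thesis by simp
  qed
qed simp

text \<open>Exchanging the sum over subsets with the sum over the simplices of \<open>c\<close> lets
  cancellation be checked on one simplex at a time, at a position that depends on the
  simplex.\<close>

lemma alternating_sum_frag_extend: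
  "alternating_sum (\<lambda>l. frag_extend (\<phi> l) c) e gs = frag_extend (\<lambda>\<tau>. alternating_sum (\<lambda>l. \<phi> l \<tau>) e gs) c"
  by (induction gs arbitrary: \<phi>) (simp_all add: frag_extend_diff_fun)

section \<open>Powers of the augmentation ideal\<close>

lemma frag_bilinear_map:
  assumes "\<And>x y. \<lbrakk>x \<in> A; y \<in> B\<rbrakk> \<Longrightarrow> f (m x y) = m' (g x) (h y)"
    and "Poly_Mapping.keys u \<subseteq> A" "Poly_Mapping.keys v \<subseteq> B"
  shows "frag_extend (\<lambda>z. frag_of (f z)) (frag_bilinear m u v)
    = frag_bilinear m' (frag_extend (\<lambda>x. frag_of (g x)) u) (frag_extend (\<lambda>y. frag_of (h y)) v)"
  using assms(2)
proof (induction u rule: frag_induction)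
  case (one x)
  show ?case using assms(3)
    by (induction v rule: frag_induction)
      (simp_all add: assms(1) \<open>x \<in> A\<close> frag_bilinear_diff_right frag_extend_diff)
qed (simp_all add: frag_bilinear_diff_left frag_extend_diff)

text \<open>Collapsing the basis to one element adds up the coefficients. In this form additivity
  and invariance under relabelling are properties of \<open>frag_extend\<close>.\<close>

lemma augmentation_alt:
  "augmentation u = Poly_Mapping.lookup (frag_extend (\<lambda>_. frag_of ()) u) ()"
proof -
  have "Poly_Mapping.lookup (\<Sum>i\<in>I. frag_cmul (k i) (frag_of ())) () = sum k I" for I and k :: "'a \<Rightarrow> int"
    by (induction I rule: infinite_finite_induct) (simp_all add: lookup_add)
  then show ?thesis by (simp add: augmentation_def frag_extend_def)
qed

lemma augmentation_simps [simp]: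
  "augmentation 0 = 0" "augmentation (frag_of g) = 1"
  "augmentation (u - v) = augmentation u - augmentation v"
  by (simp_all add: augmentation_alt frag_extend_diff lookup_minus)

lemma augmentation_map: "augmentation (frag_extend (\<lambda>g. frag_of (f g)) u) = augmentation u"
  using frag_extend_compose[of "\<lambda>_. frag_of ()" f u] by (simp add: augmentation_alt o_def)

abbreviation (input) aug_power :: "'a topology \<Rightarrow> 'a \<Rightarrow> nat \<Rightarrow> ((real \<Rightarrow> 'a) set \<Rightarrow>\<^sub>0 int) set" where
  "aug_power X a m \<equiv> augmentation_ideal (fundamental_group X a)
     [^]\<^bsub>ideals_set (group_ring (fundamental_group X a))\<^esub> m"

text \<open>The unit of the monoid of ideals is the whole ring.\<close>

lemma aug_power_0: "aug_power X a 0 = {u. Poly_Mapping.keys u \<subseteq> pi1 X a a}"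
  by (auto simp: nat_pow_def ideals_set_def group_ring_def fundamental_group_def)

lemma aug_power_Suc:
  "aug_power X a (Suc m) = ideal_prod (group_ring (fundamental_group X a)) (aug_power X a m)
     (augmentation_ideal (fundamental_group X a))"
  by (simp add: nat_pow_def ideals_set_def)

lemma mem_augmentation_ideal:
  "u \<in> augmentation_ideal (fundamental_group X a)
    \<longleftrightarrow> Poly_Mapping.keys u \<subseteq> pi1 X a a \<and> augmentation u = 0"
  by (simp add: augmentation_ideal_def group_ring_def fundamental_group_def)

lemma mult_fundamental_group_ring:
  "u \<otimes>\<^bsub>group_ring (fundamental_group X a)\<^esub> v = frag_bilinear (pi1_mult X) u v"
  "u \<oplus>\<^bsub>group_ring (fundamental_group X a)\<^esub> v = u + v"
  by (simp_all add: group_ring_def fundamental_group_def)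

text \<open>An ideal product is generated under sums by products of elements. The whole ring enters
  at once at exponent 0, so sums have to be treated only at successor exponents.\<close>

lemma aug_power_induct [consumes 1, case_names zero prod sum]:
  assumes "r \<in> aug_power X a m"
    and "\<And>r. Poly_Mapping.keys r \<subseteq> pi1 X a a \<Longrightarrow> P 0 r"
    and "\<And>m r s. \<lbrakk>r \<in> aug_power X a m; P m r; Poly_Mapping.keys s \<subseteq> pi1 X a a; augmentation s = 0\<rbrakk>
      \<Longrightarrow> P (Suc m) (frag_bilinear (pi1_mult X) r s)"
    and "\<And>m r s. \<lbrakk>P (Suc m) r; P (Suc m) s\<rbrakk> \<Longrightarrow> P (Suc m) (r + s)"
  shows "P m r"
  using assms(1)
proof (induction m arbitrary: r)
  case 0
  then show ?case unfolding aug_power_0 by (simp add: assms(2))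
next
  case (Suc m)
  from Suc.prems show ?case unfolding aug_power_Suc
    by (induction r rule: ideal_prod.induct)
      (auto simp: mult_fundamental_group_ring mem_augmentation_ideal intro!: assms(3,4) Suc.IH)
qed

lemma keys_frag_bilinear_pi1:
  assumes "Poly_Mapping.keys u \<subseteq> pi1 X b c" "Poly_Mapping.keys v \<subseteq> pi1 X a b"
  shows "Poly_Mapping.keys (frag_bilinear (pi1_mult X) u v) \<subseteq> pi1 X a c"
proof -
  have "(\<lambda>(x, y). pi1_mult X x y) ` (Poly_Mapping.keys u \<times> Poly_Mapping.keys v) \<subseteq> pi1 X a c"
    using assms by (auto intro: pi1_mult_closed)
  then show ?thesis by (rule order_trans[OF keys_frag_bilinear])
qed

lemma keys_aug_power:
  "r \<in> aug_power X a m \<Longrightarrow> Poly_Mapping.keys r \<subseteq> pi1 X a a"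
proof (induction rule: aug_power_induct)
  case (sum m r s)
  then show ?case using keys_add[of r s] by blast
qed (simp_all add: keys_frag_bilinear_pi1)

abbreviation (input) Zpi1_map ::
  "'b topology \<Rightarrow> ('a \<Rightarrow> 'b) \<Rightarrow> ((real \<Rightarrow> 'a) set \<Rightarrow>\<^sub>0 int) \<Rightarrow> ((real \<Rightarrow> 'b) set \<Rightarrow>\<^sub>0 int)" where
  "Zpi1_map Y f \<equiv> frag_extend (\<lambda>g. frag_of (pi1_map Y f g))"

lemma keys_Zpi1_map:
  assumes "continuous_map X Y f" "Poly_Mapping.keys u \<subseteq> pi1 X a b"
  shows "Poly_Mapping.keys (Zpi1_map Y f u) \<subseteq> pi1 Y (f a) (f b)"
  using keys_frag_extend[of "\<lambda>g. frag_of (pi1_map Y f g)" u] pi1_map_closed[OF _ assms(1)] assms(2)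
  by fastforce

lemma Zpi1_map_mult:
  assumes "continuous_map X Y f" "Poly_Mapping.keys u \<subseteq> pi1 X b c" "Poly_Mapping.keys v \<subseteq> pi1 X a b"
  shows "Zpi1_map Y f (frag_bilinear (pi1_mult X) u v)
    = frag_bilinear (pi1_mult Y) (Zpi1_map Y f u) (Zpi1_map Y f v)"
  using pi1_map_mult[OF _ _ assms(1)] assms(2,3) by (rule frag_bilinear_map)

text \<open>The induced map is multiplicative and preserves the augmentation, hence respects each
  product of ideals.\<close>

lemma Zpi1_map_aug_power:
  assumes f: "continuous_map X Y f"
  shows "r \<in> aug_power X a m \<Longrightarrow> Zpi1_map Y f r \<in> aug_power Y (f a) m"
proof (induction rule: aug_power_induct)
  case (zero r)
  then show ?case unfolding aug_power_0 by (auto dest: keys_Zpi1_map[OF f])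
next
  case (prod m r s)
  then have "Zpi1_map Y f s \<in> augmentation_ideal (fundamental_group Y (f a))"
    using keys_Zpi1_map[OF f] by (simp add: mem_augmentation_ideal augmentation_map)
  then show ?case
    using ideal_prod.prod[OF prod.IH, of _ _ "group_ring (fundamental_group Y (f a))"] keys_aug_power[OF prod.hyps(1)] prod.hyps
    unfolding aug_power_Suc
    by (simp add: Zpi1_map_mult[OF f] mult_fundamental_group_ring)
next
  case (sum m r s)
  then show ?case
    using ideal_prod.sum[of _ "group_ring (fundamental_group Y (f a))"]
    unfolding aug_power_Suc
    by (simp add: frag_extend_add mult_fundamental_group_ring)
qed

text \<open>The constant pieces keep the closed time intervals of the loops apart.\<close>

fun loops_then :: "'a \<Rightarrow> (real \<Rightarrow> 'a) list \<Rightarrow> (real \<Rightarrow> 'a) \<Rightarrow> real \<Rightarrow> 'a" where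
  "loops_then a [] \<gamma> = \<gamma>"
| "loops_then a (\<alpha> # l) \<gamma> = path_then (\<lambda>_. a) (path_then \<alpha> (loops_then a l \<gamma>))"

lemma Chem_loops_then:
  "\<lbrakk>set l \<subseteq> Chem X a a; \<gamma> \<in> Chem X a b\<rbrakk> \<Longrightarrow> loops_then a l \<gamma> \<in> Chem X a b"
proof (induction l)
  case (Cons \<alpha> l)
  then show ?case
    using Chem_topspace[OF Cons.prems(2)] by (auto intro!: Chem_path_then Chem_const)
qed simp

text \<open>The inserted constant pieces do not change the class. The head of the list is traversed
  first, so it becomes the rightmost factor.\<close>

lemma path_class_loops_then_Cons:
  assumes "\<alpha> \<in> Chem X a a" "set l \<subseteq> Chem X a a" "\<gamma> \<in> Chem X a b"
  shows "path_class X (loops_then a (\<alpha> # l) \<gamma>)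
    = pi1_mult X (path_class X (loops_then a l \<gamma>)) (path_class X \<alpha>)"
  using assms Chem_loops_then[OF assms(2,3)]
  by (simp add: pi1_mult_path_class path_class_eq[OF path_homotopic_const_then[OF Chem_path_then]])

text \<open>These are the expansions of [\<gamma>] ([g_m] - 1) ... ([g_1] - 1). They are indexed by
  actual paths rather than classes, so that each term comes with the timing of
  \<open>loops_then\<close>.\<close>

definition alt_products :: "'a topology \<Rightarrow> 'a \<Rightarrow> 'a \<Rightarrow> nat \<Rightarrow> ((real \<Rightarrow> 'a) set \<Rightarrow>\<^sub>0 int) set" where
  "alt_products X a b m =
     {alternating_sum (\<lambda>l. frag_of (path_class X (loops_then a l \<gamma>))) (\<lambda>_. a) gs |\<gamma> gs.
        \<gamma> \<in> Chem X a b \<and> set gs \<subseteq> Chem X a a \<and> length gs = m}"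

text \<open>Right multiplication by [\<alpha>] - 1 puts \<alpha> at the head of the list of loops,
  and an element of augmentation 0 is a combination of such differences.\<close>

lemma alt_products_mult_augmentation_ideal:
  assumes v: "v \<in> zspan (alt_products X a b m)"
    and s: "Poly_Mapping.keys s \<subseteq> pi1 X a a" "augmentation s = 0"
  shows "frag_bilinear (pi1_mult X) v s \<in> zspan (alt_products X a b (Suc m))"
  using v
proof (induction v rule: zspan.induct)
  case (base v)
  let ?c = "\<lambda>_. a"
  let ?m = "frag_bilinear (pi1_mult X)"
  let ?Z = "zspan (alt_products X a b (Suc m))"
  obtain \<gamma> gs where \<gamma>: "\<gamma> \<in> Chem X a b" and gs: "set gs \<subseteq> Chem X a a" "length gs = m"
    and v_def: "v = alternating_sum (\<lambda>l. frag_of (path_class X (loops_then a l \<gamma>))) ?c gs"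
    using base by (auto simp: alt_products_def)
  have c: "?c \<in> Chem X a a" using Chem_topspace[OF \<gamma>] by (simp add: Chem_const)
  have v_mult: "?m v (frag_of (path_class X \<alpha>))
      = alternating_sum (\<lambda>l. frag_of (path_class X (loops_then a (\<alpha> # l) \<gamma>))) ?c gs"
    if "\<alpha> \<in> Chem X a a" for \<alpha>
  proof -
    have "?m v (frag_of (path_class X \<alpha>))
        = alternating_sum (\<lambda>l. ?m (frag_of (path_class X (loops_then a l \<gamma>))) (frag_of (path_class X \<alpha>))) ?c gs"
      unfolding v_def by (rule alternating_sum_additive) (rule frag_bilinear_diff_left)
    also have "\<dots> = alternating_sum (\<lambda>l. frag_of (path_class X (loops_then a (\<alpha> # l) \<gamma>))) ?c gs"
      by (rule alternating_sum_cong[OF gs(1) c])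
        (simp add: path_class_loops_then_Cons[OF that _ \<gamma>] del: loops_then.simps)
    finally show ?thesis .
  qed
  \<comment> \<open>The correction term makes the claim meaningful for every augmentation and linear
    in \<open>s\<close>, so that induction from the basis applies.\<close>
  have "?m v s - frag_cmul (augmentation s) (?m v (frag_of (path_class X ?c))) \<in> ?Z"
    using s(1)
  proof (induction s rule: frag_induction)
    case (one g)
    then obtain \<alpha> where \<alpha>: "\<alpha> \<in> Chem X a a" "g = path_class X \<alpha>" by (auto simp: pi1_def)
    have "?m v (frag_of g) - ?m v (frag_of (path_class X ?c))
        = alternating_sum (\<lambda>l. frag_of (path_class X (loops_then a l \<gamma>))) ?c (\<alpha> # gs)"
      by (simp add: \<alpha> v_mult[OF \<alpha>(1)] v_mult[OF c])
    moreover have "\<dots> \<in> alt_products X a b (Suc m)"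
      unfolding alt_products_def using \<alpha>(1) \<gamma> gs
      by (intro CollectI exI[of _ \<gamma>] exI[of _ "\<alpha> # gs"]) simp
    ultimately show ?case by (simp add: zspan.base)
  next
    case (diff s t)
    then have "(?m v s - frag_cmul (augmentation s) (?m v (frag_of (path_class X ?c))))
      - (?m v t - frag_cmul (augmentation t) (?m v (frag_of (path_class X ?c)))) \<in> ?Z"
      by (rule zspan.diff)
    then show ?case
      by (simp add: frag_bilinear_diff_right frag_cmul_diff_distrib algebra_simps)
  qed (simp add: zspan.zero)
  then show ?case using s(2) by simp
qed (auto simp: frag_bilinear_diff_left intro: zspan.intros)

text \<open>Each further factor of augmentation 0 lengthens the lists of loops by one; associativity
  brings \<open>u\<close> next to the lower power first.\<close>

lemma mult_aug_power_subset:
  assumes u: "Poly_Mapping.keys u \<subseteq> pi1 X a b"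
  shows "r \<in> aug_power X a m \<Longrightarrow> frag_bilinear (pi1_mult X) u r \<in> zspan (alt_products X a b m)"
proof (induction rule: aug_power_induct)
  case (zero r)
  have "Poly_Mapping.keys (frag_bilinear (pi1_mult X) u r) \<subseteq> pi1 X a b"
    using u zero by (rule keys_frag_bilinear_pi1)
  then show ?case
  proof (induction rule: frag_induction)
    case (one g)
    then obtain \<gamma> where "\<gamma> \<in> Chem X a b" "g = path_class X \<gamma>" by (auto simp: pi1_def)
    then have "frag_of g \<in> alt_products X a b 0"
      unfolding alt_products_def by (intro CollectI exI[of _ \<gamma>] exI[of _ "[]"]) simp
    then show ?case by (rule zspan.base)
  qed (auto intro: zspan.intros)
next
  case (prod m r s)
  have "frag_bilinear (pi1_mult X) u (frag_bilinear (pi1_mult X) r s)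
      = frag_bilinear (pi1_mult X) (frag_bilinear (pi1_mult X) u r) s"
    using u keys_aug_power[OF prod.hyps(1)] prod.hyps(2)
    by (intro sym[OF frag_bilinear_assoc] pi1_mult_assoc)
  then show ?case
    using alt_products_mult_augmentation_ideal[OF prod.IH] prod.hyps by simp
next
  case (sum m r s)
  then show ?case by (simp add: frag_bilinear_add_right zspan_add)
qed

section \<open>The singular simplices of a path\<close>

abbreviation simplex_space :: "nat \<Rightarrow> (nat \<Rightarrow> real) topology" where
  "simplex_space n \<equiv> subtopology (powertop_real UNIV) (standard_simplex n)"

abbreviation id_simplex :: "nat \<Rightarrow> (nat \<Rightarrow> real) chain" where
  "id_simplex n \<equiv> frag_of (restrict id (standard_simplex n))"

definition simplex_boundary :: "nat \<Rightarrow> (nat \<Rightarrow> real) set" where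
  "simplex_boundary n = {s \<in> standard_simplex n. \<exists>k\<le>n. s k = 0}"

lemma topspace_simplex_space [simp]: "topspace (simplex_space n) = standard_simplex n"
  by (simp add: topspace_standard_simplex)

lemma singular_simplex_id: "singular_simplex n (simplex_space n) (restrict id (standard_simplex n))"
  by (auto simp: singular_simplex_def)

lemma singular_chain_id_simplex: "singular_chain n (simplex_space n) (id_simplex n)"
  by (simp only: singular_chain_of singular_simplex_id)

text \<open>The k-th face has k-th barycentric coordinate 0. Every \<open>path_simplex\<close> is an
  image of this universal cycle, so its cycle property, homotopy invariance and subdivision follow
  by naturality.\<close>

lemma singular_relcycle_id_simplex:
  "singular_relcycle n (simplex_space n) (simplex_boundary n) (id_simplex n)"
proof -
  have "singular_chain (n - 1) (subtopology (simplex_space n) (simplex_boundary n))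
      (chain_boundary n (id_simplex n))"
  proof (cases n)
    case (Suc m)
    have "singular_simplex (n - 1) (subtopology (simplex_space n) (simplex_boundary n))
        (singular_face n k (restrict id (standard_simplex n)))" if "k \<le> n" for k
    proof (rule iffD2[OF singular_simplex_subtopology], rule conjI)
      show "singular_simplex (n - 1) (simplex_space n) (singular_face n k (restrict id (standard_simplex n)))"
        using singular_simplex_singular_face[OF singular_simplex_id _ that] Suc by simp
      show "singular_face n k (restrict id (standard_simplex n)) ` standard_simplex (n - 1) \<subseteq> simplex_boundary n"
        using simplical_face_in_standard_simplex[OF _ that] that Suc
        by (force simp: singular_face_def simplex_boundary_def simplical_face_def)
    qed
    moreover have "n \<noteq> 0" using Suc by simp
    ultimately show ?thesis
      unfolding chain_boundary_of
      by (simp only: if_False) (intro singular_chain_sum singular_chain_cmul; simp only: singular_chain_of atMost_iff)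
  qed (simp add: chain_boundary_def)
  then show ?thesis
    by (simp only: singular_relcycle singular_chain_id_simplex)
qed

definition path_power :: "nat \<Rightarrow> (real \<Rightarrow> 'a) \<Rightarrow> (nat \<Rightarrow> real) \<Rightarrow> nat \<Rightarrow> 'a" where
  "path_power n \<gamma> s = (\<lambda>i\<in>{1..n}. \<gamma> (\<Sum>j<i. s j))"

lemma path_simplex_eq_chain_map:
  "frag_of (path_simplex n \<gamma>) = chain_map n (path_power n \<gamma>) (id_simplex n)"
  by (auto simp: path_simplex_def simplex_map_def path_power_def intro!: arg_cong[of _ _ frag_of])

lemma standard_simplex_partial_sum:
  assumes "s \<in> standard_simplex n" "i \<le> Suc n"
  shows "(\<Sum>j<i. s j) \<in> {0..1}"
proof -
  have "(\<Sum>j<i. s j) \<le> (\<Sum>j\<le>n. s j)"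
    using assms by (intro sum_mono2) (auto simp: standard_simplex_def)
  then show ?thesis
    using assms by (auto simp: standard_simplex_def intro: sum_nonneg)
qed

lemma continuous_map_partial_sum:
  assumes "i \<le> Suc n"
  shows "continuous_map (simplex_space n) (top_of_set {0..1}) (\<lambda>s. \<Sum>j<i. s j)"
proof -
  have "continuous_map (simplex_space n) euclideanreal (\<lambda>s. \<Sum>j<i. s j)"
    by (intro continuous_map_sum continuous_map_from_subtopology continuous_map_product_projection) auto
  then show ?thesis
    using standard_simplex_partial_sum assms by (auto simp: continuous_map_in_subtopology)
qed

text \<open>If \<open>s k = 0\<close>, the partial sums that give the times t_k and t_(k+1)
  coincide; the conventions t_0 = 0 and t_(n+1) = 1 produce the base points. The hypothesis concerns
  values only, so that it can be met by every stage of a homotopy.\<close>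

lemma path_power_in_diag_union:
  assumes top: "\<And>i. i \<in> {1..n} \<Longrightarrow> \<gamma> (\<Sum>j<i. s j) \<in> topspace X"
    and s: "s \<in> simplex_boundary n" and ends: "\<gamma> 0 = a" "\<gamma> 1 = b"
  shows "path_power n \<gamma> s \<in> diag_union n (X, a, b)"
proof -
  obtain k where k: "k \<le> n" "s k = 0" and s': "s \<in> standard_simplex n"
    using s by (auto simp: simplex_boundary_def)
  have coord: "bounded_coord n a b (path_power n \<gamma> s) i = \<gamma> (\<Sum>j<i. s j)" if "i \<le> Suc n" for i
  proof -
    have "(\<Sum>j<Suc n. s j) = 1"
      using s' by (simp add: standard_simplex_def lessThan_Suc_atMost)
    then show ?thesis
      using that ends by (auto simp: bounded_coord_def path_power_def)
  qed
  have "bounded_coord n a b (path_power n \<gamma> s) k = bounded_coord n a b (path_power n \<gamma> s) (k + 1)"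
    using k by (simp add: coord)
  moreover have "path_power n \<gamma> s \<in> topspace (top_power n X)"
    using top by (auto simp: top_power_def path_power_def)
  ultimately show ?thesis
    using k(1) by (auto simp: diag_union_def)
qed

text \<open>Apply the homotopy of paths in every coordinate. Each stage still runs from
  \<open>a\<close> to \<open>b\<close>, so it sends the boundary into the diagonals.\<close>

lemma homotopic_path_power:
  assumes "path_homotopic X \<gamma> \<delta>" "\<gamma> \<in> Chem X a b"
  shows "homotopic_with (\<lambda>h. h \<in> simplex_boundary n \<rightarrow> diag_union n (X, a, b))
    (simplex_space n) (top_power n X) (path_power n \<gamma>) (path_power n \<delta>)"
proof -
  have ends: "\<gamma> 0 = a" "\<gamma> 1 = b" using assms(2) by (simp_all add: Chem_def)
  obtain h where h: "continuous_map (prod_topology (top_of_set {0..1::real}) (top_of_set {0..1})) X h"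
      "\<And>x. h (0, x) = \<gamma> x" "\<And>x. h (1, x) = \<delta> x"
      "\<And>t. t \<in> {0..1} \<Longrightarrow> h (t, 0) = a \<and> h (t, 1) = b"
    using assms(1) unfolding path_homotopic_def homotopic_with_def ends by blast
  show ?thesis
    unfolding homotopic_with_def
  proof (intro exI[of _ "\<lambda>(t, s). path_power n (\<lambda>x. h (t, x)) s"] conjI allI ballI)
    let ?P = "prod_topology (top_of_set {0..1::real}) (simplex_space n)"
    have "continuous_map ?P X (\<lambda>z. h (fst z, \<Sum>j<i. snd z j))" if "i \<in> {1..n}" for i
    proof -
      have "continuous_map ?P (top_of_set {0..1}) ((\<lambda>s. \<Sum>j<i. s j) \<circ> snd)"
        using that by (intro continuous_map_compose[OF continuous_map_snd] continuous_map_partial_sum) simp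
      then have "continuous_map ?P (prod_topology (top_of_set {0..1}) (top_of_set {0..1}))
          (\<lambda>z. (fst z, \<Sum>j<i. snd z j))"
        by (intro continuous_map_pairedI continuous_map_fst) (simp add: o_def)
      then show ?thesis
        using continuous_map_compose[OF _ h(1)] by (simp add: o_def)
    qed
    then show "continuous_map ?P (top_power n X) (\<lambda>(t, s). path_power n (\<lambda>x. h (t, x)) s)"
      unfolding top_power_def continuous_map_componentwise
      by (auto simp: path_power_def split_def)
    show "(\<lambda>s. case (t, s) of (t, s) \<Rightarrow> path_power n (\<lambda>x. h (t, x)) s)
        \<in> simplex_boundary n \<rightarrow> diag_union n (X, a, b)" if t: "t \<in> {0..1}" for t
    proof
      fix s assume s: "s \<in> simplex_boundary n"
      then have "(\<Sum>j<i. s j) \<in> {0..1}" if "i \<in> {1..n}" for i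
        using that standard_simplex_partial_sum[of s n i] by (auto simp: simplex_boundary_def)
      then have "h (t, \<Sum>j<i. s j) \<in> topspace X" if "i \<in> {1..n}" for i
        using that t continuous_map_image_subset_topspace[OF h(1)] by (force simp: image_subset_iff)
      then show "(case (t, s) of (t, s) \<Rightarrow> path_power n (\<lambda>x. h (t, x)) s) \<in> diag_union n (X, a, b)"
        using s h(4)[OF t] by (auto intro!: path_power_in_diag_union)
    qed
  qed (auto simp: h)
qed

lemma path_power_pair_map:
  assumes "\<gamma> \<in> Chem X a b"
  shows "continuous_map (simplex_space n) (top_power n X) (path_power n \<gamma>)"
    and "path_power n \<gamma> \<in> simplex_boundary n \<rightarrow> diag_union n (X, a, b)"
  using homotopic_with_imp_continuous_maps homotopic_with_imp_property
    homotopic_path_power[OF path_homotopic_refl[OF assms] assms] by blast+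

lemma singular_relcycle_path_simplex:
  assumes "\<gamma> \<in> Chem X a b"
  shows "singular_relcycle n (top_power n X) (diag_union n (X, a, b)) (frag_of (path_simplex n \<gamma>))"
  unfolding path_simplex_eq_chain_map
  using singular_relcycle_chain_map[OF singular_relcycle_id_simplex] path_power_pair_map[OF assms] by blast

lemma path_simplex_class_cong:
  assumes "path_homotopic X \<gamma> \<delta>" "\<gamma> \<in> Chem X a b"
  shows "path_simplex_class n (X, a, b) \<delta> = path_simplex_class n (X, a, b) \<gamma>"
  unfolding path_simplex_class_def homologous_rel_set_eq path_simplex_eq_chain_map fst_conv
  using homotopic_imp_homologous_rel_chain_maps[OF homotopic_path_power[OF assms] singular_relcycle_id_simplex]
  by (simp add: homologous_rel_sym)

text \<open>The time interval in which \<^const>\<open>loops_then\<close> runs through the \<open>i\<close>-th loop of the list.\<close>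

fun loop_time :: "nat \<Rightarrow> real set" where
  "loop_time 0 = {1/2..3/4}"
| "loop_time (Suc i) = (\<lambda>t. 4 * t - 3) -` loop_time i"

lemma closed_loop_time: "closed (loop_time i)"
  by (induction i) (auto intro!: closed_vimage continuous_intros)

lemma loop_time_ge: "t \<in> loop_time i \<Longrightarrow> 1/2 \<le> t"
  by (induction i arbitrary: t) fastforce+

text \<open>An interval of positive index consists of t with 4t - 3 at least 1/2, that is t at least
  7/8, beyond the interval [1/2,3/4] of index 0. Rescaling reduces two positive indices to smaller
  ones.\<close>

lemma loop_time_disjoint: "\<lbrakk>t \<in> loop_time i; t \<in> loop_time j\<rbrakk> \<Longrightarrow> i = j"
proof (induction i arbitrary: j t)
  case 0
  then show ?case by (cases j) (auto dest: loop_time_ge)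
next
  case (Suc i)
  then show ?case by (cases j) (auto dest: loop_time_ge)
qed

text \<open>Unfolding the two nested concatenations, the path is constant up to 1/2, runs through
  the first loop up to 3/4, and then follows the remaining path at time 4t - 3.\<close>

lemma loops_then_outside_loop_time:
  assumes "t \<notin> loop_time (length xs)"
  shows "loops_then a (xs @ \<alpha> # ys) \<gamma> t = loops_then a (xs @ \<beta> # ys) \<gamma> t"
  using assms by (induction xs arbitrary: t) (auto simp: path_then_def algebra_simps)

definition avoiding :: "nat \<Rightarrow> nat \<Rightarrow> (nat \<Rightarrow> real) set" where
  "avoiding n i = {s \<in> standard_simplex n. \<forall>k\<in>{1..n}. (\<Sum>j<k. s j) \<notin> loop_time i}"

lemma openin_avoiding: "openin (simplex_space n) (avoiding n i)"
proof -
  have "openin (simplex_space n) {s \<in> topspace (simplex_space n). (\<Sum>j<k. s j) \<in> {0..1} - loop_time i}"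
    if "k \<in> {1..n}" for k
    using that continuous_map_partial_sum[of k n]
    by (intro openin_continuous_map_preimage) (auto simp: openin_open closed_loop_time open_Compl
        intro!: exI[of _ "- loop_time i"])
  \<comment> \<open>For \<open>n = 0\<close> there are no times and the indexed intersection is
    everything, so the intersection with the whole space matters.\<close>
  moreover have "avoiding n i = (\<Inter>k\<in>{1..n}.
      {s \<in> topspace (simplex_space n). (\<Sum>j<k. s j) \<in> {0..1} - loop_time i}) \<inter> topspace (simplex_space n)"
    using standard_simplex_partial_sum by (fastforce simp: avoiding_def)
  ultimately show ?thesis
    using openin_INT[of "{1..n}" "simplex_space n"] by (metis (no_types, lifting) finite_atLeastAtMost)
qed

text \<open>Pigeonhole: if all n + 1 disjoint intervals were hit, choosing a time in each would
  inject \<open>{..n}\<close> into \<open>{1..n}\<close>.\<close>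

lemma avoiding_cover: "standard_simplex n \<subseteq> (\<Union>i\<le>n. avoiding n i)"
proof (rule ccontr)
  assume "\<not> ?thesis"
  then obtain s where "s \<in> standard_simplex n" "\<And>i. i \<le> n \<Longrightarrow> \<exists>k\<in>{1..n}. (\<Sum>j<k. s j) \<in> loop_time i"
    by (fastforce simp: avoiding_def)
  then obtain f where f: "\<And>i. i \<le> n \<Longrightarrow> f i \<in> {1..n}" "\<And>i. i \<le> n \<Longrightarrow> (\<Sum>j<f i. s j) \<in> loop_time i"
    by metis
  have "inj_on f {..n}"
  proof
    fix i j assume "i \<in> {..n}" "j \<in> {..n}" "f i = f j"
    then show "i = j"
      using f(2)[of i] f(2)[of j] by (auto intro: loop_time_disjoint)
  qed
  moreover have "f ` {..n} \<subseteq> {1..n}"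
    using f(1) by blast
  ultimately have "card {..n} \<le> card {1..n}"
    by (rule card_inj_on_le) simp
  then show False by simp
qed

section \<open>Iterated subdivision and the vanishing of alternating chains\<close>

lemma naturality_iterated_singular_subdivision:
  assumes "singular_chain p X c"
  shows "(singular_subdivision p ^^ N) (chain_map p g c) = chain_map p g ((singular_subdivision p ^^ N) c)"
proof -
  have "singular_chain p X ((singular_subdivision p ^^ N) c)" for N
    by (induction N) (simp_all add: assms singular_chain_singular_subdivision)
  then show ?thesis
    by (induction N) (simp_all add: naturality_singular_subdivision[of p X])
qed

lemma homologous_rel_iterated_singular_subdivision:
  assumes "singular_relcycle p X S c"
  shows "homologous_rel p X S ((singular_subdivision p ^^ N) c) c"
proof (induction N)
  case (Suc N)
  then have "singular_relcycle p X S ((singular_subdivision p ^^ N) c)"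
    using assms homologous_rel_singular_relcycle by blast
  then show ?case
    using homologous_rel_trans[OF Suc homologous_rel_singular_subdivision] by simp
qed simp

text \<open>A sufficiently fine subdivision of the chain is 0, and subdivision does not change the
  relative class of a cycle.\<close>

lemma alt_path_simplex_relboundary:
  assumes \<gamma>: "\<gamma> \<in> Chem X a b" and gs: "set gs \<subseteq> Chem X a a" "length gs = n + 1"
  shows "singular_relboundary n (top_power n X) (diag_union n (X, a, b))
    (alternating_sum (\<lambda>l. frag_of (path_simplex n (loops_then a l \<gamma>))) (\<lambda>_. a) gs)" (is "?B (alternating_sum ?F _ _)")
proof -
  let ?c = "\<lambda>_. a"
  have c: "?c \<in> Chem X a a" using Chem_topspace[OF \<gamma>] by (simp add: Chem_const)
  \<comment> \<open>Only the universal simplex is subdivided, so one \<open>N\<close> serves all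
    terms of the alternating sum.\<close>
  obtain N where N: "\<And>\<tau>. \<tau> \<in> Poly_Mapping.keys ((singular_subdivision n ^^ N) (id_simplex n))
      \<Longrightarrow> \<exists>V\<in>avoiding n ` {..n}. \<tau> \<in> standard_simplex n \<rightarrow> V"
  proof (rule sufficient_iterated_singular_subdivision_exists)
    show "topspace (simplex_space n) \<subseteq> \<Union>(avoiding n ` {..n})"
      using avoiding_cover by simp
    show "singular_chain n (simplex_space n) (id_simplex n)"
      by (rule singular_chain_id_simplex)
  qed (use openin_avoiding in blast)+
  let ?S = "singular_subdivision n ^^ N"
  have "?S (alternating_sum ?F ?c gs) = alternating_sum (\<lambda>l. ?S (?F l)) ?c gs"
    by (rule alternating_sum_additive) (rule singular_subdivision_power_diff)
  also have "\<dots> = alternating_sum (\<lambda>l. chain_map n (path_power n (loops_then a l \<gamma>)) (?S (id_simplex n))) ?c gs"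
    unfolding path_simplex_eq_chain_map
    by (simp only: naturality_iterated_singular_subdivision[OF singular_chain_id_simplex])
  also have "\<dots> = frag_extend (\<lambda>\<tau>. alternating_sum (\<lambda>l. frag_of (simplex_map n (path_power n (loops_then a l \<gamma>)) \<tau>)) ?c gs)
      (?S (id_simplex n))"
    by (simp add: chain_map_def o_def alternating_sum_frag_extend)
  also have "\<dots> = 0"
  proof (rule frag_extend_eq_0)
    fix \<tau> assume "\<tau> \<in> Poly_Mapping.keys (?S (id_simplex n))"
    \<comment> \<open>The small simplex \<tau> avoids the time interval of this loop, so the terms
      do not depend on the entry at position \<open>i\<close>.\<close>
    then obtain i where i: "i \<le> n" "\<tau> \<in> standard_simplex n \<rightarrow> avoiding n i" using N by fastforce
    show "alternating_sum (\<lambda>l. frag_of (simplex_map n (path_power n (loops_then a l \<gamma>)) \<tau>)) ?c gs = 0"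
    proof (rule alternating_sum_eq_0[of i])
      fix xs ys :: "(real \<Rightarrow> 'a) list" and \<alpha> \<beta> :: "real \<Rightarrow> 'a" assume "length xs = i"
      then have "path_power n (loops_then a (xs @ \<alpha> # ys) \<gamma>) s = path_power n (loops_then a (xs @ \<beta> # ys) \<gamma>) s"
        if "s \<in> avoiding n i" for s
        using that loops_then_outside_loop_time[of _ xs a \<alpha> ys \<gamma> \<beta>]
        by (auto simp: path_power_def avoiding_def)
      then show "frag_of (simplex_map n (path_power n (loops_then a (xs @ \<alpha> # ys) \<gamma>)) \<tau>)
          = frag_of (simplex_map n (path_power n (loops_then a (xs @ \<beta> # ys) \<gamma>)) \<tau>)"
        using i(2) by (auto simp: simplex_map_def fun_eq_iff Pi_iff intro!: arg_cong[of _ _ frag_of])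
    qed (use i gs in simp)
  qed
  finally have S0: "?S (alternating_sum ?F ?c gs) = 0" .
  have "singular_relcycle n (top_power n X) (diag_union n (X, a, b)) (alternating_sum ?F ?c gs)"
    using alternating_sum_rel[OF gs(1) c, of "\<lambda>u _. singular_relcycle n (top_power n X) (diag_union n (X, a, b)) u" ?F ?F]
      singular_relcycle_path_simplex[OF Chem_loops_then[OF _ \<gamma>]] singular_relcycle_diff by blast
  then have "homologous_rel n (top_power n X) (diag_union n (X, a, b)) (?S (alternating_sum ?F ?c gs)) (alternating_sum ?F ?c gs)"
    by (rule homologous_rel_iterated_singular_subdivision)
  then show ?thesis
    \<comment> \<open>Being homologous to 0 says that the negative of the chain bounds, hence the
      sign change.\<close>
    using singular_relboundary_minus unfolding S0 homologous_rel_def by fastforce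
qed

lemma hom_free_Abelian_group_eq:
  assumes G: "group G" and hom: "h \<in> hom (free_Abelian_group S) G" "h' \<in> hom (free_Abelian_group S) G"
    and eq: "\<And>x. x \<in> S \<Longrightarrow> h (frag_of x) = h' (frag_of x)"
    and u: "Poly_Mapping.keys u \<subseteq> S"
  shows "h u = h' u"
proof -
  interpret G: group G by fact
  interpret h: group_hom "free_Abelian_group S" G h using G hom by (simp add: group_hom_def group_hom_axioms_def)
  interpret h': group_hom "free_Abelian_group S" G h' using G hom by (simp add: group_hom_def group_hom_axioms_def)
  show ?thesis
    using u
  proof (rule free_Abelian_group_induct)
    show "h 0 = h' 0" using h.hom_one h'.hom_one by simp
  next
    fix x y assume xy: "Poly_Mapping.keys x \<subseteq> S" "Poly_Mapping.keys y \<subseteq> S" "h x = h' x" "h y = h' y"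
    then have k: "Poly_Mapping.keys (x - y) \<subseteq> S" using keys_diff[of x y] by blast
    \<comment> \<open>The target is written multiplicatively; the value at \<open>x - y\<close> is
      found by cancelling the value at \<open>y\<close>.\<close>
    have "h (x - y) \<otimes>\<^bsub>G\<^esub> h y = h' (x - y) \<otimes>\<^bsub>G\<^esub> h y"
      using h.hom_mult[of "x - y" y] h'.hom_mult[of "x - y" y] xy k by simp
    then show "h (x - y) = h' (x - y)"
      using h.hom_closed[of "x - y"] h'.hom_closed[of "x - y"] h.hom_closed[of y] xy k by simp
  qed (simp add: eq)
qed

section \<open>The functor $\mathbf F_n$\<close>

lemma Zpi1_sub_eq:
  "Zpi1_sub n (X, a, b) = generate (Zpi1 (X, a, b))
     {frag_bilinear (pi1_mult X) u r |u r. Poly_Mapping.keys u \<subseteq> pi1 X a b \<and> r \<in> aug_power X a (n + 1)}"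
  by (simp add: Zpi1_sub_def Zpi1_def Let_def)

lemma comm_group_Zpi1: "comm_group (Zpi1 \<X>)"
  by (simp add: Zpi1_def abelian_free_Abelian_group split_def)

lemma group_Zpi1: "group (Zpi1 \<X>)"
  by (simp add: Zpi1_def split_def)

lemma subgroup_Zpi1_sub:
  fixes \<X> :: "'a top2"
  shows "subgroup (Zpi1_sub n \<X>) (Zpi1 \<X>)"
proof -
  obtain X a b where \<X>: "\<X> = (X, a, b)" by (cases \<X>) auto
  show ?thesis
    unfolding \<X> Zpi1_sub_eq
  proof (rule group.generate_is_subgroup[OF group_Zpi1], clarify)
    fix u r :: "(real \<Rightarrow> 'a) set \<Rightarrow>\<^sub>0 int"
    assume "Poly_Mapping.keys u \<subseteq> pi1 X a b" "r \<in> aug_power X a (n + 1)"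
    then show "frag_bilinear (pi1_mult X) u r \<in> carrier (Zpi1 (X, a, b))"
      using keys_frag_bilinear_pi1[OF _ keys_aug_power] by (simp only: Zpi1_def prod.case carrier_free_Abelian_group_iff)
  qed
qed

text \<open>The kernel is a subgroup, so testing the generating products suffices. This serves both
  the induced maps on F_n and \<nu>.\<close>

lemma hom_trivial_on_Zpi1_sub:
  fixes X :: "'a topology"
  assumes H: "group H" and h: "h \<in> hom (Zpi1 (X, a, b)) H"
    and triv: "\<And>u r. \<lbrakk>Poly_Mapping.keys u \<subseteq> pi1 X a b; r \<in> aug_power X a (n + 1)\<rbrakk>
      \<Longrightarrow> h (frag_bilinear (pi1_mult X) u r) = \<one>\<^bsub>H\<^esub>"
    and v: "v \<in> Zpi1_sub n (X, a, b)"
  shows "h v = \<one>\<^bsub>H\<^esub>"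
proof -
  interpret h: group_hom "Zpi1 (X, a, b)" H h
    using H h group_Zpi1 by (auto simp: group_hom_def group_hom_axioms_def)
  have "Zpi1_sub n (X, a, b) \<subseteq> kernel (Zpi1 (X, a, b)) H h"
    unfolding Zpi1_sub_eq
  proof (rule group.generate_subgroup_incl[OF group_Zpi1 _ h.subgroup_kernel], clarify)
    fix u r :: "(real \<Rightarrow> 'a) set \<Rightarrow>\<^sub>0 int"
    assume ur: "Poly_Mapping.keys u \<subseteq> pi1 X a b" "r \<in> aug_power X a (n + 1)"
    then show "frag_bilinear (pi1_mult X) u r \<in> kernel (Zpi1 (X, a, b)) H h"
      using triv[OF ur] keys_frag_bilinear_pi1[OF ur(1) keys_aug_power[OF ur(2)]]
      by (simp add: kernel_def Zpi1_def)
  qed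
  then show ?thesis using v by (auto simp: kernel_def)
qed

lemma comm_group_F_obj: "comm_group (F_obj n \<X>)"
  unfolding F_obj_def using comm_group.abelian_FactGroup[OF comm_group_Zpi1 subgroup_Zpi1_sub] .

lemma normal_Zpi1_sub: "Zpi1_sub n \<X> \<lhd> Zpi1 \<X>"
  by (simp add: comm_group.normal_iff_subgroup comm_group_Zpi1 subgroup_Zpi1_sub)

lemma F_proj_hom: "F_proj n \<X> \<in> hom (Zpi1 \<X>) (F_obj n \<X>)"
  using normal.r_coset_hom_Mod[OF normal_Zpi1_sub] by (simp add: F_proj_def[abs_def] F_obj_def)

lemma carrier_F_obj: "carrier (F_obj n \<X>) = F_proj n \<X> ` carrier (Zpi1 \<X>)"
  by (auto simp: F_obj_def FactGroup_def RCOSETS_def F_proj_def)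

lemma F_proj_eq_one: "u \<in> Zpi1_sub n \<X> \<Longrightarrow> F_proj n \<X> u = \<one>\<^bsub>F_obj n \<X>\<^esub>"
  using group.coset_join2[OF group_Zpi1 _ subgroup_Zpi1_sub] subgroup.subset[OF subgroup_Zpi1_sub]
  by (fastforce simp: F_proj_def F_obj_def FactGroup_def)

lemma Zpi1_map_hom:
  assumes "continuous_map X Y f"
  shows "Zpi1_map Y f \<in> hom (Zpi1 (X, a, b)) (Zpi1 (Y, f a, f b))"
  using keys_Zpi1_map[OF assms] by (auto simp: hom_def Zpi1_def frag_extend_add)

text \<open>The map on group rings followed by the projection kills the products u r, because it
  sends them to products of the same kind over the target.\<close>

lemma F_mor_hom_and_proj:
  assumes f: "f \<in> top2_hom \<X> \<Y>"
  shows "F_mor n \<X> \<Y> f \<in> hom (F_obj n \<X>) (F_obj n \<Y>)"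
    and "u \<in> carrier (Zpi1 \<X>) \<Longrightarrow> F_mor n \<X> \<Y> f (F_proj n \<X> u) = F_proj n \<Y> (Zpi1_map (fst \<Y>) f u)"
proof -
  obtain X a b where \<X>: "\<X> = (X, a, b)" by (cases \<X>) auto
  obtain Y where \<Y>: "\<Y> = (Y, f a, f b)" and cont: "continuous_map X Y f"
    using f by (cases \<Y>) (auto simp: top2_hom_def \<X>)
  let ?h = "\<lambda>u. F_proj n \<Y> (Zpi1_map Y f u)"
  have grp: "group (F_obj n \<Y>)" using comm_group_F_obj by (rule comm_group.axioms)
  have hom: "?h \<in> hom (Zpi1 \<X>) (F_obj n \<Y>)"
    using hom_compose[OF Zpi1_map_hom[OF cont] F_proj_hom] by (simp add: \<X> \<Y> o_def)
  have "?h (frag_bilinear (pi1_mult X) u r) = \<one>\<^bsub>F_obj n \<Y>\<^esub>"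
    if u: "Poly_Mapping.keys u \<subseteq> pi1 X a b" and r: "r \<in> aug_power X a (n + 1)" for u r
    unfolding Zpi1_map_mult[OF cont u keys_aug_power[OF r]]
    using keys_Zpi1_map[OF cont u] Zpi1_map_aug_power[OF cont r]
    by (intro F_proj_eq_one) (auto simp only: \<Y> Zpi1_sub_eq intro!: generate.incl)
  then have triv: "?h v = \<one>\<^bsub>F_obj n \<Y>\<^esub>" if "v \<in> Zpi1_sub n \<X>" for v
    using hom_trivial_on_Zpi1_sub[OF grp, of ?h X a b n v] hom that by (simp only: \<X>)
  note * = hom_FactGroup_induced_map[OF comm_group_Zpi1 subgroup_Zpi1_sub grp hom triv]
  show "F_mor n \<X> \<Y> f \<in> hom (F_obj n \<X>) (F_obj n \<Y>)"
    using *(2) by (simp add: F_mor_def F_obj_def[of n \<X>] \<Y>)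
  show "F_mor n \<X> \<Y> f (F_proj n \<X> u) = F_proj n \<Y> (Zpi1_map (fst \<Y>) f u)"
    if "u \<in> carrier (Zpi1 \<X>)" for u
    using *(1)[OF _ that] by (simp add: F_mor_def F_proj_def[of n \<X>] \<Y>)
qed

section \<open>Identities, composites and the functor laws\<close>

lemma top2_id_hom: "top2_obj \<X> \<Longrightarrow> top2_id \<X> \<in> top2_hom \<X> \<X>"
  by (cases \<X>) (auto simp: top2_obj_def top2_id_def top2_hom_def intro: continuous_map_eq[OF continuous_map_id])

lemma top2_comp_hom:
  assumes "top2_obj \<X>" "f \<in> top2_hom \<X> \<Y>" "g \<in> top2_hom \<Y> \<Z>"
  shows "top2_comp \<X> g f \<in> top2_hom \<X> \<Z>"
  using assms
  by (cases \<X>; cases \<Y>; cases \<Z>) (auto simp: top2_obj_def top2_comp_def top2_hom_def compose_def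
      intro: continuous_map_eq[OF continuous_map_compose])

lemma Zpi1_map_ident:
  assumes "Poly_Mapping.keys u \<subseteq> pi1 X a b" "\<And>x. x \<in> topspace X \<Longrightarrow> f x = x"
  shows "Zpi1_map X f u = u"
proof -
  have "pi1_map X f g = g" if g: "g \<in> pi1 X a b" for g
  proof -
    obtain \<gamma> where "\<gamma> \<in> Chem X a b" "g = path_class X \<gamma>" using g by (auto simp: pi1_def)
    then show ?thesis
      using pi1_map_cong[OF g continuous_map_id, of f] assms(2) pi1_map_path_class[OF _ continuous_map_id, of \<gamma>]
      by simp
  qed
  then have "Zpi1_map X f u = frag_extend frag_of u"
    using assms(1) by (intro frag_extend_eq) auto
  then show ?thesis using frag_expansion by metis
qed

lemma Zpi1_map_compose:
  assumes "Poly_Mapping.keys u \<subseteq> pi1 X a b" "continuous_map X Y f" "continuous_map Y Z g"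
    and "\<And>x. x \<in> topspace X \<Longrightarrow> h x = g (f x)"
  shows "Zpi1_map Z h u = Zpi1_map Z g (Zpi1_map Y f u)"
proof -
  have cont: "continuous_map X Z (g \<circ> f)" using assms by (rule_tac continuous_map_compose)
  have "pi1_map Z h p = pi1_map Z g (pi1_map Y f p)" if p: "p \<in> pi1 X a b" for p
  proof -
    obtain \<gamma> where "\<gamma> \<in> Chem X a b" "p = path_class X \<gamma>" using p by (auto simp: pi1_def)
    then show ?thesis
      using pi1_map_cong[OF p cont, of h] assms(4) pi1_map_path_class[OF _ cont, of \<gamma>]
        pi1_map_path_class[OF _ assms(2), of \<gamma>] pi1_map_path_class[OF Chem_compose[OF _ assms(2)] assms(3), of \<gamma>]
      by (simp add: o_assoc)
  qed
  then have "Zpi1_map Z h u = frag_extend (\<lambda>p. frag_of (pi1_map Z g (pi1_map Y f p))) u"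
    using assms(1) by (intro frag_extend_eq) auto
  also have "\<dots> = Zpi1_map Z g (Zpi1_map Y f u)"
    using frag_extend_compose[of "\<lambda>p. frag_of (pi1_map Z g p)" "pi1_map Y f" u] by (simp add: o_def)
  finally show ?thesis .
qed

lemma F_mor_id:
  assumes "top2_obj \<X>" "C \<in> carrier (F_obj n \<X>)"
  shows "F_mor n \<X> \<X> (top2_id \<X>) C = C"
proof -
  obtain X a b where \<X>: "\<X> = (X, a, b)" by (cases \<X>) auto
  obtain u where u: "u \<in> carrier (Zpi1 \<X>)" "C = F_proj n \<X> u" using assms(2) by (auto simp: carrier_F_obj)
  then have "Zpi1_map X (top2_id \<X>) u = u"
    by (intro Zpi1_map_ident) (auto simp: \<X> Zpi1_def top2_id_def)
  then show ?thesis
    using F_mor_hom_and_proj(2)[OF top2_id_hom[OF assms(1)] u(1)] by (simp add: u(2) \<X>)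
qed

lemma F_mor_comp:
  assumes "top2_obj \<X>" and f: "f \<in> top2_hom \<X> \<Y>" and g: "g \<in> top2_hom \<Y> \<Z>"
    and C: "C \<in> carrier (F_obj n \<X>)"
  shows "F_mor n \<X> \<Z> (top2_comp \<X> g f) C = F_mor n \<Y> \<Z> g (F_mor n \<X> \<Y> f C)"
proof -
  obtain X a b where \<X>: "\<X> = (X, a, b)" by (cases \<X>) auto
  obtain Y where \<Y>: "\<Y> = (Y, f a, f b)" and cf: "continuous_map X Y f"
    using f by (cases \<Y>) (auto simp: top2_hom_def \<X>)
  have cg: "continuous_map Y (fst \<Z>) g" using g by (cases \<Z>) (auto simp: top2_hom_def \<Y>)
  obtain u where u: "u \<in> carrier (Zpi1 \<X>)" "C = F_proj n \<X> u" using C by (auto simp: carrier_F_obj)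
  have fu: "Zpi1_map Y f u \<in> carrier (Zpi1 \<Y>)"
    using hom_in_carrier[OF Zpi1_map_hom[OF cf, of a b]] u(1) by (simp add: \<X> \<Y>)
  have "Zpi1_map (fst \<Z>) (top2_comp \<X> g f) u = Zpi1_map (fst \<Z>) g (Zpi1_map Y f u)"
    using u(1) by (intro Zpi1_map_compose[OF _ cf cg]) (auto simp: \<X> Zpi1_def top2_comp_def compose_def)
  then show ?thesis
    using F_mor_hom_and_proj(2)[OF top2_comp_hom[OF assms(1) f g] u(1)]
      F_mor_hom_and_proj(2)[OF f u(1)] F_mor_hom_and_proj(2)[OF g fu]
    by (simp add: u(2) \<Y>)
qed

section \<open>The functor $\mathbf H_n$\<close>

definition power_map :: "nat \<Rightarrow> ('a \<Rightarrow> 'b) \<Rightarrow> (nat \<Rightarrow> 'a) \<Rightarrow> nat \<Rightarrow> 'b" where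
  "power_map n f x = (\<lambda>i\<in>{1..n}. f (x i))"

lemma H_mor_eq:
  "H_mor n \<X> \<Y> f = hom_induced (int n) (top_power n (fst \<X>)) (diag_union n \<X>)
     (top_power n (fst \<Y>)) (diag_union n \<Y>) (power_map n f)"
  by (simp add: H_mor_def power_map_def[abs_def])

lemma continuous_map_power_map:
  assumes "continuous_map X Y f"
  shows "continuous_map (top_power n X) (top_power n Y) (power_map n f)"
  unfolding top_power_def continuous_map_componentwise
proof (intro conjI ballI)
  fix i assume i: "i \<in> {1..n}"
  have "continuous_map (product_topology (\<lambda>i. X) {1..n}) Y (f \<circ> (\<lambda>x. x i))"
    using continuous_map_product_projection[OF i] assms by (rule continuous_map_compose)
  then show "continuous_map (product_topology (\<lambda>i. X) {1..n}) Y (\<lambda>x. power_map n f x i)"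
    using i by (simp add: power_map_def o_def)
qed (auto simp: power_map_def)

lemma power_map_pair_map:
  assumes "f \<in> top2_hom \<X> \<Y>"
  shows "continuous_map (top_power n (fst \<X>)) (top_power n (fst \<Y>)) (power_map n f)"
    and "power_map n f \<in> diag_union n \<X> \<rightarrow> diag_union n \<Y>"
proof -
  obtain X a b where \<X>: "\<X> = (X, a, b)" by (cases \<X>) auto
  obtain Y where \<Y>: "\<Y> = (Y, f a, f b)" and cont: "continuous_map X Y f"
    using assms by (cases \<Y>) (auto simp: top2_hom_def \<X>)
  show cont': "continuous_map (top_power n (fst \<X>)) (top_power n (fst \<Y>)) (power_map n f)"
    using continuous_map_power_map[OF cont] by (simp add: \<X> \<Y>)
  show "power_map n f \<in> diag_union n \<X> \<rightarrow> diag_union n \<Y>"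
  proof
    fix x assume x: "x \<in> diag_union n \<X>"
    \<comment> \<open>The base points at positions 0 and n + 1 are carried along by \<open>f\<close>
      too, so equal neighbours stay equal.\<close>
    have "bounded_coord n (f a) (f b) (power_map n f x) i = f (bounded_coord n a b x i)"
      if "i \<le> n + 1" for i
      using that by (auto simp: bounded_coord_def power_map_def)
    moreover have "power_map n f x \<in> topspace (top_power n Y)"
      using x cont' by (auto simp: diag_union_def \<X> \<Y> continuous_map_def Pi_iff)
    moreover obtain i where "i \<le> n" "bounded_coord n a b x i = bounded_coord n a b x (i + 1)"
      using x by (auto simp: diag_union_def \<X>)
    ultimately show "power_map n f x \<in> diag_union n \<Y>"
      by (auto simp: diag_union_def \<Y> intro!: bexI[of _ i])
  qed
qed

lemma power_map_apply:
  "x \<in> topspace (top_power n X) \<Longrightarrow> i \<in> {1..n} \<Longrightarrow> x i \<in> topspace X"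
  by (auto simp: top_power_def PiE_iff)

lemma comm_group_H_obj: "comm_group (H_obj n \<X>)"
  by (simp add: H_obj_def)

lemma H_mor_hom: "H_mor n \<X> \<Y> f \<in> hom (H_obj n \<X>) (H_obj n \<Y>)"
  by (simp add: H_mor_eq H_obj_def hom_induced_hom)

lemma H_mor_id:
  assumes "top2_obj \<X>" "c \<in> carrier (H_obj n \<X>)"
  shows "H_mor n \<X> \<X> (top2_id \<X>) c = c"
  unfolding H_mor_eq
proof (rule hom_induced_id_gen)
  show "power_map n (top2_id \<X>) x = x" if x: "x \<in> topspace (top_power n (fst \<X>))" for x
  proof
    fix i show "power_map n (top2_id \<X>) x i = x i"
      using power_map_apply[OF x] x
      \<comment> \<open>Points of the power are extensional, so both sides are
        \<open>undefined\<close> at indices outside \<open>{1..n}\<close>.\<close>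
      by (cases \<X>) (auto simp: power_map_def top2_id_def top_power_def PiE_iff extensional_def)
  qed
  show "continuous_map (top_power n (fst \<X>)) (top_power n (fst \<X>)) (power_map n (top2_id \<X>))"
    using power_map_pair_map(1)[OF top2_id_hom[OF assms(1)]] .
qed (use assms(2) in \<open>simp add: H_obj_def\<close>)

lemma H_mor_comp:
  assumes f: "f \<in> top2_hom \<X> \<Y>" and g: "g \<in> top2_hom \<Y> \<Z>"
  shows "H_mor n \<X> \<Z> (top2_comp \<X> g f) c = H_mor n \<Y> \<Z> g (H_mor n \<X> \<Y> f c)"
proof -
  have "power_map n (top2_comp \<X> g f) x = (power_map n g \<circ> power_map n f) x"
    if "x \<in> topspace (top_power n (fst \<X>))" for x
    using power_map_apply[OF that]
    by (cases \<X>) (auto simp: power_map_def top2_comp_def compose_def fun_eq_iff)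
  then have "H_mor n \<X> \<Z> (top2_comp \<X> g f) = hom_induced (int n) (top_power n (fst \<X>)) (diag_union n \<X>)
     (top_power n (fst \<Z>)) (diag_union n \<Z>) (power_map n g \<circ> power_map n f)"
    unfolding H_mor_eq by (rule hom_induced_eq)
  then show ?thesis
    using hom_induced_compose'[OF power_map_pair_map[OF f] power_map_pair_map[OF g]]
    by (simp add: H_mor_eq)
qed

section \<open>The natural transformation\<close>

lemma homologous_rel_set_hom:
  "homologous_rel_set p X S \<in> hom (relcycle_group p X S) (relative_homology_group (int p) X S)"
  using normal.r_coset_hom_Mod[OF normal_subgroup_singular_relboundary_relcycle]
  by (simp add: right_coset_singular_relboundary nontrivial_relative_homology_group)

lemma homologous_rel_set_add:
  assumes "singular_relcycle p X S c" "singular_relcycle p X S d"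
  shows "homologous_rel_set p X S c \<otimes>\<^bsub>relative_homology_group (int p) X S\<^esub> homologous_rel_set p X S d
    = homologous_rel_set p X S (c + d)"
  using hom_mult[OF homologous_rel_set_hom, of c p X S d] assms by simp

lemma homologous_rel_set_closed:
  "singular_relcycle p X S c \<Longrightarrow> homologous_rel_set p X S c \<in> carrier (relative_homology_group (int p) X S)"
  by (auto simp: carrier_relative_homology_group)

lemma induced_map_path_simplex_class:
  assumes "\<gamma> \<in> Chem X a b"
  shows "induced_map (path_simplex_class n (X, a, b)) (path_class X \<gamma>) = path_simplex_class n (X, a, b) \<gamma>"
proof -
  have "path_simplex_class n (X, a, b) \<delta> = path_simplex_class n (X, a, b) \<gamma>" if "\<delta> \<in> path_class X \<gamma>" for \<delta>
    using that by (intro path_simplex_class_cong[OF _ assms]) (simp add: path_class_def)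
  then have "path_simplex_class n (X, a, b) ` path_class X \<gamma> = {path_simplex_class n (X, a, b) \<gamma>}"
    using mem_path_class_self[OF assms] by blast
  then show ?thesis by (simp add: induced_map_def)
qed

lemma path_simplex_class_closed:
  "\<gamma> \<in> Chem X a b \<Longrightarrow> path_simplex_class n (X, a, b) \<gamma> \<in> carrier (H_obj n (X, a, b))"
  using homologous_rel_set_closed[OF singular_relcycle_path_simplex]
  by (simp add: path_simplex_class_def H_obj_def)

lemma Zpi1_to_H_hom: "Zpi1_to_H n (X, a, b) \<in> hom (Zpi1 (X, a, b)) (H_obj n (X, a, b))"
  unfolding Zpi1_to_H_def Zpi1_def prod.case
  by (rule comm_group.free_Abelian_hom_hom[OF comm_group_H_obj])
    (auto simp: pi1_def induced_map_path_simplex_class path_simplex_class_closed)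

lemma Zpi1_to_H_path_class:
  "\<gamma> \<in> Chem X a b \<Longrightarrow> Zpi1_to_H n (X, a, b) (frag_of (path_class X \<gamma>)) = path_simplex_class n (X, a, b) \<gamma>"
  by (simp add: Zpi1_to_H_def comm_group.free_Abelian_hom_of[OF comm_group_H_obj]
      induced_map_path_simplex_class path_simplex_class_closed)

text \<open>The image of the alternating sum of path classes is represented by the alternating chain
  of path simplices, which bounds.\<close>

lemma Zpi1_to_H_alt_products:
  assumes "v \<in> alt_products X a b (n + 1)"
  shows "v \<in> carrier (Zpi1 (X, a, b)) \<and> Zpi1_to_H n (X, a, b) v = \<one>\<^bsub>H_obj n (X, a, b)\<^esub>"
proof -
  let ?H = "H_obj n (X, a, b)" and ?Z = "Zpi1_to_H n (X, a, b)"
  let ?T = "top_power n X" and ?D = "diag_union n (X, a, b)"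
  let ?c = "\<lambda>_. a"
  interpret H: comm_group ?H by (rule comm_group_H_obj)
  obtain \<gamma> gs where \<gamma>: "\<gamma> \<in> Chem X a b" and gs: "set gs \<subseteq> Chem X a a" "length gs = n + 1"
    and v: "v = alternating_sum (\<lambda>l. frag_of (path_class X (loops_then a l \<gamma>))) ?c gs"
    using assms by (auto simp: alt_products_def)
  have c: "?c \<in> Chem X a a" using Chem_topspace[OF \<gamma>] by (simp add: Chem_const)
  \<comment> \<open>\<open>P u d\<close> says that the chain \<open>d\<close> represents the image
    of \<open>u\<close>; its stability under differences is what \<open>alternating_sum_rel\<close>
    asks for.\<close>
  define P where "P u d \<longleftrightarrow> u \<in> carrier (Zpi1 (X, a, b)) \<and> singular_relcycle n ?T ?D d
    \<and> ?Z u = homologous_rel_set n ?T ?D d" for u d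
  have "P (alternating_sum (\<lambda>l. frag_of (path_class X (loops_then a l \<gamma>))) ?c gs)
      (alternating_sum (\<lambda>l. frag_of (path_simplex n (loops_then a l \<gamma>))) ?c gs)"
  proof (rule alternating_sum_rel[OF gs(1) c])
    fix l assume "set l \<subseteq> Chem X a a"
    then have "loops_then a l \<gamma> \<in> Chem X a b" using \<gamma> by (rule Chem_loops_then)
    then show "P (frag_of (path_class X (loops_then a l \<gamma>))) (frag_of (path_simplex n (loops_then a l \<gamma>)))"
      by (simp add: P_def Zpi1_def path_class_in_pi1 singular_relcycle_path_simplex Zpi1_to_H_path_class
          path_simplex_class_def)
  next
    fix u d u' d' assume P: "P u d" "P u' d'"
    then have carr: "u - u' \<in> carrier (Zpi1 (X, a, b))"
      using keys_diff[of u u'] by (auto simp: P_def Zpi1_def)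
    have "?Z (u - u') \<otimes>\<^bsub>?H\<^esub> ?Z u' = ?Z u"
      using hom_mult[OF Zpi1_to_H_hom carr, of u'] P by (simp add: P_def Zpi1_def)
    also have "\<dots> = homologous_rel_set n ?T ?D (d - d') \<otimes>\<^bsub>?H\<^esub> ?Z u'"
      using P by (simp add: P_def H_obj_def homologous_rel_set_add singular_relcycle_diff)
    finally have "?Z (u - u') \<otimes>\<^bsub>?H\<^esub> ?Z u' = homologous_rel_set n ?T ?D (d - d') \<otimes>\<^bsub>?H\<^esub> ?Z u'" .
    moreover have "homologous_rel_set n ?T ?D (d - d') \<in> carrier ?H"
      using homologous_rel_set_closed[of n ?T ?D "d - d'"] P
      by (simp add: P_def singular_relcycle_diff H_obj_def)
    moreover have "?Z (u - u') \<in> carrier ?H" "?Z u' \<in> carrier ?H"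
      using P(2)[unfolded P_def] by (blast intro: hom_in_carrier[OF Zpi1_to_H_hom] carr)+
    ultimately have "?Z (u - u') = homologous_rel_set n ?T ?D (d - d')"
      using H.right_cancel by blast
    then show "P (u - u') (d - d')"
      using P carr by (simp add: P_def singular_relcycle_diff)
  qed
  then have "v \<in> carrier (Zpi1 (X, a, b))" "?Z v = singular_relboundary_set n ?T ?D"
    using alt_path_simplex_relboundary[OF \<gamma> gs] by (simp_all add: v P_def homologous_rel_set_eq_relboundary)
  then show ?thesis by (simp add: H_obj_def)
qed

text \<open>The generating products lie in the span of alternating sums with n + 1 loops; these go
  to the unit, and so do their differences.\<close>

lemma Zpi1_to_H_Zpi1_sub:
  fixes X :: "'a topology"
  assumes "v \<in> Zpi1_sub n (X, a, b)"
  shows "Zpi1_to_H n (X, a, b) v = \<one>\<^bsub>H_obj n (X, a, b)\<^esub>"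
proof (rule hom_trivial_on_Zpi1_sub[OF _ Zpi1_to_H_hom _ assms])
  let ?H = "H_obj n (X, a, b)" and ?Z = "Zpi1_to_H n (X, a, b)"
  interpret H: comm_group ?H by (rule comm_group_H_obj)
  show "group ?H" by (rule H.is_group)
  interpret Z: group_hom "Zpi1 (X, a, b)" ?H ?Z
    using group_Zpi1 Zpi1_to_H_hom H.is_group by (auto simp: group_hom_def group_hom_axioms_def)
  fix u r :: "(real \<Rightarrow> 'a) set \<Rightarrow>\<^sub>0 int"
  assume "Poly_Mapping.keys u \<subseteq> pi1 X a b" "r \<in> aug_power X a (n + 1)"
  then have "frag_bilinear (pi1_mult X) u r \<in> zspan (alt_products X a b (n + 1))"
    by (rule mult_aug_power_subset)
  then have "frag_bilinear (pi1_mult X) u r \<in> carrier (Zpi1 (X, a, b))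
      \<and> ?Z (frag_bilinear (pi1_mult X) u r) = \<one>\<^bsub>?H\<^esub>"
  proof (induction rule: zspan.induct)
    case zero
    show ?case using Z.hom_one by (simp add: Zpi1_def)
  next
    case (base v)
    then show ?case by (rule Zpi1_to_H_alt_products)
  next
    case (diff v w)
    then have carr: "v - w \<in> carrier (Zpi1 (X, a, b))"
      using keys_diff[of v w] by (auto simp: Zpi1_def)
    moreover have "?Z (v - w) = \<one>\<^bsub>?H\<^esub>"
      using Z.hom_mult[OF carr, of w] Z.hom_closed[OF carr] diff by (simp add: Zpi1_def)
    ultimately show ?case by blast
  qed
  then show "?Z (frag_bilinear (pi1_mult X) u r) = \<one>\<^bsub>?H\<^esub>" by blast
qed

lemma nu_hom_and_proj:
  shows "nu n (X, a, b) \<in> hom (F_obj n (X, a, b)) (H_obj n (X, a, b))"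
    and "u \<in> carrier (Zpi1 (X, a, b)) \<Longrightarrow> nu n (X, a, b) (F_proj n (X, a, b) u) = Zpi1_to_H n (X, a, b) u"
  using hom_FactGroup_induced_map[OF comm_group_Zpi1 subgroup_Zpi1_sub
      comm_group.axioms(2)[OF comm_group_H_obj] Zpi1_to_H_hom Zpi1_to_H_Zpi1_sub]
  by (simp_all add: nu_def F_obj_def F_proj_def)

text \<open>Both composites are homomorphisms from a free abelian group, so it is enough to compare
  them on the class of one path.\<close>

lemma Zpi1_to_H_natural:
  assumes f: "f \<in> top2_hom \<X> \<Y>" and u: "u \<in> carrier (Zpi1 \<X>)"
  shows "Zpi1_to_H n \<Y> (Zpi1_map (fst \<Y>) f u) = H_mor n \<X> \<Y> f (Zpi1_to_H n \<X> u)"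
proof -
  obtain X a b where \<X>: "\<X> = (X, a, b)" by (cases \<X>) auto
  obtain Y where \<Y>: "\<Y> = (Y, f a, f b)" and cont: "continuous_map X Y f"
    using f by (cases \<Y>) (auto simp: top2_hom_def \<X>)
  have "(Zpi1_to_H n \<Y> \<circ> Zpi1_map Y f) u = (H_mor n \<X> \<Y> f \<circ> Zpi1_to_H n \<X>) u"
  proof (rule hom_free_Abelian_group_eq[where S = "pi1 X a b"])
    show "group (H_obj n \<Y>)" using comm_group_H_obj by (rule comm_group.axioms)
    show "Zpi1_to_H n \<Y> \<circ> Zpi1_map Y f \<in> hom (free_Abelian_group (pi1 X a b)) (H_obj n \<Y>)"
      using hom_compose[OF Zpi1_map_hom[OF cont, of a b] Zpi1_to_H_hom, of n] by (simp add: \<Y> Zpi1_def)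
    show "H_mor n \<X> \<Y> f \<circ> Zpi1_to_H n \<X> \<in> hom (free_Abelian_group (pi1 X a b)) (H_obj n \<Y>)"
      using hom_compose[OF Zpi1_to_H_hom[of n X a b] H_mor_hom] by (simp add: \<X> Zpi1_def)
    show "Poly_Mapping.keys u \<subseteq> pi1 X a b" using u by (simp add: \<X> Zpi1_def)
    fix g assume "g \<in> pi1 X a b"
    then obtain \<gamma> where \<gamma>: "\<gamma> \<in> Chem X a b" and g: "g = path_class X \<gamma>" by (auto simp: pi1_def)
    \<comment> \<open>At the level of simplices naturality is an equality: both sides evaluate
      \<open>f \<circ> \<gamma>\<close> at the same partial sums.\<close>
    have simplex: "simplex_map n (power_map n f) (path_simplex n \<gamma>) = path_simplex n (f \<circ> \<gamma>)"
      by (auto simp: simplex_map_def power_map_def path_simplex_def fun_eq_iff)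
    have cycle: "singular_relcycle n (top_power n (fst \<X>)) (diag_union n \<X>) (frag_of (path_simplex n \<gamma>))"
      using singular_relcycle_path_simplex[OF \<gamma>] by (simp add: \<X>)
    have "H_mor n \<X> \<Y> f (path_simplex_class n \<X> \<gamma>) = path_simplex_class n \<Y> (f \<circ> \<gamma>)"
      unfolding H_mor_eq path_simplex_class_def
        hom_induced_chain_map[OF power_map_pair_map[OF f] cycle] chain_map_of simplex ..
    then show "(Zpi1_to_H n \<Y> \<circ> Zpi1_map Y f) (frag_of g) = (H_mor n \<X> \<Y> f \<circ> Zpi1_to_H n \<X>) (frag_of g)"
      using \<gamma> Chem_compose[OF \<gamma> cont]
      by (simp add: g \<X> \<Y> pi1_map_path_class[OF \<gamma> cont] Zpi1_to_H_path_class)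
  qed
  then show ?thesis by (simp add: \<Y>)
qed

lemma nu_natural:
  assumes f: "f \<in> top2_hom \<X> \<Y>" and C: "C \<in> carrier (F_obj n \<X>)"
  shows "nu n \<Y> (F_mor n \<X> \<Y> f C) = H_mor n \<X> \<Y> f (nu n \<X> C)"
proof -
  obtain X a b where \<X>: "\<X> = (X, a, b)" by (cases \<X>) auto
  obtain Y where \<Y>: "\<Y> = (Y, f a, f b)" and cont: "continuous_map X Y f"
    using f by (cases \<Y>) (auto simp: top2_hom_def \<X>)
  obtain u where u: "u \<in> carrier (Zpi1 \<X>)" "C = F_proj n \<X> u" using C by (auto simp: carrier_F_obj)
  have "Zpi1_map Y f u \<in> carrier (Zpi1 \<Y>)"
    using hom_in_carrier[OF Zpi1_map_hom[OF cont, of a b]] u(1) by (simp add: \<X> \<Y>)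
  then show ?thesis
    using F_mor_hom_and_proj(2)[OF f u(1)] Zpi1_to_H_natural[OF f u(1)] u
    by (simp add: \<X> \<Y> nu_hom_and_proj(2))
qed

(* The conjuncts: F_n is a functor to abelian groups (three), so is H_n (three), the morphism on
   Z pi_1(a,b) exists and induces nu, naturality of nu. *)
theorem mainTheorem3:
  fixes n :: nat
  shows
    "(\<forall>\<X> :: 'a top2. top2_obj \<X> \<longrightarrow>
        comm_group (F_obj n \<X>) \<and>
        (\<forall>C\<in>carrier (F_obj n \<X>). F_mor n \<X> \<X> (top2_id \<X>) C = C)) \<and>
     (\<forall>(\<X> :: 'a top2) (\<Y> :: 'b top2). top2_obj \<X> \<and> top2_obj \<Y> \<longrightarrow>
        (\<forall>f\<in>top2_hom \<X> \<Y>.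
           F_mor n \<X> \<Y> f \<in> hom (F_obj n \<X>) (F_obj n \<Y>) \<and>
           (\<forall>u\<in>carrier (Zpi1 \<X>). F_mor n \<X> \<Y> f (F_proj n \<X> u) =
              F_proj n \<Y> (frag_extend (\<lambda>g. frag_of (pi1_map (fst \<Y>) f g)) u)))) \<and>
     (\<forall>(\<X> :: 'a top2) (\<Y> :: 'b top2) (\<Z> :: 'c top2).
        top2_obj \<X> \<and> top2_obj \<Y> \<and> top2_obj \<Z> \<longrightarrow>
        (\<forall>f\<in>top2_hom \<X> \<Y>. \<forall>g\<in>top2_hom \<Y> \<Z>. \<forall>C\<in>carrier (F_obj n \<X>).
           F_mor n \<X> \<Z> (top2_comp \<X> g f) C = F_mor n \<Y> \<Z> g (F_mor n \<X> \<Y> f C))) \<and>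
     (\<forall>\<X> :: 'a top2. top2_obj \<X> \<longrightarrow>
        comm_group (H_obj n \<X>) \<and>
        (\<forall>c\<in>carrier (H_obj n \<X>). H_mor n \<X> \<X> (top2_id \<X>) c = c)) \<and>
     (\<forall>(\<X> :: 'a top2) (\<Y> :: 'b top2). top2_obj \<X> \<and> top2_obj \<Y> \<longrightarrow>
        (\<forall>f\<in>top2_hom \<X> \<Y>. H_mor n \<X> \<Y> f \<in> hom (H_obj n \<X>) (H_obj n \<Y>))) \<and>
     (\<forall>(\<X> :: 'a top2) (\<Y> :: 'b top2) (\<Z> :: 'c top2).
        top2_obj \<X> \<and> top2_obj \<Y> \<and> top2_obj \<Z> \<longrightarrow>
        (\<forall>f\<in>top2_hom \<X> \<Y>. \<forall>g\<in>top2_hom \<Y> \<Z>. \<forall>c\<in>carrier (H_obj n \<X>).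
           H_mor n \<X> \<Z> (top2_comp \<X> g f) c = H_mor n \<Y> \<Z> g (H_mor n \<X> \<Y> f c))) \<and>
     (\<forall>(X :: 'a topology) a b. top2_obj (X, a, b) \<longrightarrow>
        Zpi1_to_H n (X, a, b) \<in> hom (Zpi1 (X, a, b)) (H_obj n (X, a, b)) \<and>
        (\<forall>\<gamma>\<in>Chem X a b.
           Zpi1_to_H n (X, a, b) (frag_of (path_class X \<gamma>)) = path_simplex_class n (X, a, b) \<gamma>) \<and>
        (\<forall>u\<in>Zpi1_sub n (X, a, b). Zpi1_to_H n (X, a, b) u = \<one>\<^bsub>H_obj n (X, a, b)\<^esub>) \<and>
        nu n (X, a, b) \<in> hom (F_obj n (X, a, b)) (H_obj n (X, a, b)) \<and>
        (\<forall>u\<in>carrier (Zpi1 (X, a, b)).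
           nu n (X, a, b) (F_proj n (X, a, b) u) = Zpi1_to_H n (X, a, b) u)) \<and>
     (\<forall>(\<X> :: 'a top2) (\<Y> :: 'b top2). top2_obj \<X> \<and> top2_obj \<Y> \<longrightarrow>
        (\<forall>f\<in>top2_hom \<X> \<Y>. \<forall>C\<in>carrier (F_obj n \<X>).
           nu n \<Y> (F_mor n \<X> \<Y> f C) = H_mor n \<X> \<Y> f (nu n \<X> C)))"
proof (intro conjI allI ballI impI)
qed (simp_all add: comm_group_F_obj F_mor_id F_mor_hom_and_proj F_mor_comp comm_group_H_obj H_mor_id
    H_mor_hom H_mor_comp Zpi1_to_H_hom Zpi1_to_H_path_class Zpi1_to_H_Zpi1_sub nu_hom_and_proj nu_natural)

end
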